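(* Let $G$ be an infinite dihedral group. (1) $\mathcal B(G)$ is neither seminormal nor weakly Krull. (2) $\mathcal L(G)=\{L\subseteq\mathbb N_{\ge 2}:L\text{ is finite and nonempty}\}\cup\{\{0\},\{1\}\}$, whence $\Delta(G)=\mathbb N$ and $\mathcal U_k(G)=\mathbb N_{\ge 2}$ for all $k\ge 2$. (3) $\mathcal B(G)$ is an FF-monoid, but not locally tame, and $\mathsf c(G)=\omega(G)=\infty$.
   Context: The infinite dihedral group is $\langle\alpha,\tau:\tau^2=1,\alpha\tau=\tau\alpha^{-1}\rangle$. A monoid is a commutative cancellative semigroup with identity; $\mathsf q(H)$ is the quotient group of $H$. $\mathbb N$ is the set of positive integers. $\mathcal F(G)$ is the free abelian monoid with basis $G$. For $S=g_1\boldsymbol{\cdot}\ldots\boldsymbol{\cdot}g_\ell\in\mathcal F(G)$ let $\pi(S)=\{g_{\sigma(1)}\cdots g_{\sigma(\ell)}:\sigma\text{ a permutation of }[1,\ell]\}\subseteq G$ ($=\{1_G\}$ for the empty sequence). $\mathcal B(G)=\{S\in\mathcal F(G):1_G\in\pi(S)\}$, the (reduced, atomic) monoid of product-one sequences. $H$ is seminormal if $x\in\mathsf q(H)$ and $x^m\in H$ for all sufficiently large $m$ imply $x\in H$ (equivalently: $x^2,x^3\in H$ imply $x\in H$). An $s$-ideal is $X\subseteq H$ with $XH=X$; $\mathfrak X(H)$ is the set of minimal nonempty prime $s$-ideals; $H_{\mathfrak p}=\{s_1/s_2:s_1\in H,s_2\in H\setminus\mathfrak p\}$. $H$ is weakly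 Krull if $H=\bigcap_{\mathfrak p\in\mathfrak X(H)}H_{\mathfrak p}$ and $\{\mathfrak p\in\mathfrak X(H):a\in\mathfrak p\}$ is finite for all $a\in H$. For a reduced atomic monoid $H$ with atoms $\mathcal A(H)$: $\mathsf Z(a)$ is the set of factorizations of $a$, i.e. elements of the free abelian monoid $\mathcal F(\mathcal A(H))$ whose product in $H$ is $a$; $\mathsf L(a)=\{|z|:z\in\mathsf Z(a)\}$; $H$ is an FF-monoid if $\mathsf Z(a)$ is finite for all $a\in H$; $\mathcal L(H)=\{\mathsf L(a):a\in H\}$; $\Delta(L)$ is the set of $d\in\mathbb N$ such that $L\cap[l,l+d]=\{l,l+d\}$ for some $l\in L$, and $\Delta(H)=\bigcup_{L\in\mathcal L(H)}\Delta(L)$; $\mathcal U_k(H)=\bigcup_{k\in L\in\mathcal L(H)}L$. $\omega(H,a)$ is the smallest $N\in\mathbb N\cup\{\infty\}$ such that whenever $a\mid a_1\cdots a_n$ with $a_i\in H$, there is $\Omega\subseteq[1,n]$ with $|\Omega|\le N$ and $a\mid\prod_{i\in\Omega}a_i$; $\omega(H)=\sup\{\omega(H,u):u\in\mathcal A(H)\}$. For factorizations $z,z'$, $\mathsf d(z,z')=\max\{|z|,|z'|\}-|\gcd(z,z')|$. For $u\in\mathcal A(H)$, $\mathsf t(H,u)$ is the smallest $N\in\mathbb N_0\cup\{\infty\}$ such that if $a\in H$ has a factorization in which $u$ occurs, then for every $z\in\mathsf Z(a)$ there is $z'\in\mathsf Z(a)$ in which $u$ occurs with $\mathsf d(z,z')\le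 N$; $H$ is locally tame if $\mathsf t(H,u)<\infty$ for all $u\in\mathcal A(H)$. The catenary degree $\mathsf c(H)$ is the smallest $N\in\mathbb N_0\cup\{\infty\}$ such that for every $a\in H$ and $z,z'\in\mathsf Z(a)$ there are $z=z_0,\ldots,z_k=z'$ in $\mathsf Z(a)$ with $\mathsf d(z_{i-1},z_i)\le N$ for all $i\in[1,k]$. For each invariant $\ast$, $\ast(G)$ means $\ast(\mathcal B(G))$. *)

theory Defs
  imports "HOL-Algebra.Divisibility" "HOL-Algebra.FiniteProduct" "HOL-Library.Extended_Nat" "HOL-Library.Multiset"
begin

section \<open>The infinite dihedral group\<close>

text \<open>
  A word over the generators is a list of letters; the letter \<open>(x, True)\<close> stands for the
  generator \<open>x\<close> and \<open>(x, False)\<close> for its formal inverse. The relators are given as pairs of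
  words \<open>(u, v)\<close>, read as \<open>u = v\<close>.
\<close>

type_synonym 'x gword = "('x \<times> bool) list"

inductive word_cong :: "('x gword \<times> 'x gword) set \<Rightarrow> 'x gword \<Rightarrow> 'x gword \<Rightarrow> bool"
  for R where
  refl: "word_cong R w w"
| sym: "word_cong R u v \<Longrightarrow> word_cong R v u"
| trans: "word_cong R u v \<Longrightarrow> word_cong R v w \<Longrightarrow> word_cong R u w"
| append: "word_cong R u u' \<Longrightarrow> word_cong R v v' \<Longrightarrow> word_cong R (u @ v) (u' @ v')"
| cancel: "word_cong R [(x, b), (x, \<not> b)] []"
| relator: "(u, v) \<in> R \<Longrightarrow> word_cong R u v"

definition presented_group :: "('x gword \<times> 'x gword) set \<Rightarrow> 'x gword set monoid" where
  "presented_group R =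
     \<lparr>carrier = UNIV // {(u, v). word_cong R u v},
      monoid.mult = (\<lambda>A B. {w. \<exists>u\<in>A. \<exists>v\<in>B. word_cong R (u @ v) w}),
      monoid.one = {w. word_cong R [] w}\<rparr>"

datatype dihedral_gen = Alpha | Tau

definition infinite_dihedral_group :: "dihedral_gen gword set monoid" where
  "infinite_dihedral_group = presented_group
     {([(Tau, True), (Tau, True)], []),
      ([(Alpha, True), (Tau, True)], [(Tau, True), (Alpha, False)])}"


section \<open>The monoid of product-one sequences\<close>

text \<open>Sequences over \<open>G\<close> are the elements of the free abelian monoid with basis \<open>carrier G\<close>,
  i.e. finite multisets of elements of \<open>carrier G\<close>.\<close>

definition sequences_over :: "('a, 'b) monoid_scheme \<Rightarrow> 'a multiset set" where
  "sequences_over G = {S. set_mset S \<subseteq> carrier G}"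

definition seq_products :: "('a, 'b) monoid_scheme \<Rightarrow> 'a multiset \<Rightarrow> 'a set" where
  "seq_products G S = {foldr (\<otimes>\<^bsub>G\<^esub>) gs \<one>\<^bsub>G\<^esub> | gs. mset gs = S}"

definition product_one_monoid :: "('a, 'b) monoid_scheme \<Rightarrow> 'a multiset monoid" where
  "product_one_monoid G =
     \<lparr>carrier = {S \<in> sequences_over G. \<one>\<^bsub>G\<^esub> \<in> seq_products G S},
      monoid.mult = (+),
      monoid.one = {#}\<rparr>"


section \<open>Quotient group, seminormality, weakly Krull monoids\<close>

text \<open>The quotient group of a commutative cancellative monoid \<open>H\<close> consists of the fractions
  \<open>a / b\<close>, the pair \<open>(a, b)\<close> being taken modulo \<open>a / b = c / d \<longleftrightarrow> a d = c b\<close>. The monoid \<open>H\<close>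
  is identified with its image under \<open>quot_embed H\<close>.\<close>

definition quot_rel :: "('a, 'b) monoid_scheme \<Rightarrow> (('a \<times> 'a) \<times> ('a \<times> 'a)) set" where
  "quot_rel H = {((a, b), (c, d)). a \<in> carrier H \<and> b \<in> carrier H \<and> c \<in> carrier H \<and> d \<in> carrier H \<and>
     a \<otimes>\<^bsub>H\<^esub> d = c \<otimes>\<^bsub>H\<^esub> b}"

definition quot :: "('a, 'b) monoid_scheme \<Rightarrow> 'a \<Rightarrow> 'a \<Rightarrow> ('a \<times> 'a) set" where
  "quot H a b = quot_rel H `` {(a, b)}"

definition quot_group :: "('a, 'b) monoid_scheme \<Rightarrow> ('a \<times> 'a) set monoid" where
  "quot_group H =
     \<lparr>carrier = (carrier H \<times> carrier H) // quot_rel H,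
      monoid.mult = (\<lambda>X Y. \<Union>(a, b)\<in>X. \<Union>(c, d)\<in>Y. quot H (a \<otimes>\<^bsub>H\<^esub> c) (b \<otimes>\<^bsub>H\<^esub> d)),
      monoid.one = quot H \<one>\<^bsub>H\<^esub> \<one>\<^bsub>H\<^esub>\<rparr>"

definition quot_embed :: "('a, 'b) monoid_scheme \<Rightarrow> 'a \<Rightarrow> ('a \<times> 'a) set" where
  "quot_embed H a = quot H a \<one>\<^bsub>H\<^esub>"

definition seminormal :: "('a, 'b) monoid_scheme \<Rightarrow> bool" where
  "seminormal H \<longleftrightarrow>
     (\<forall>x\<in>carrier (quot_group H).
        (\<exists>M::nat. \<forall>m\<ge>M. x [^]\<^bsub>quot_group H\<^esub> m \<in> quot_embed H ` carrier H) \<longrightarrow>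
        x \<in> quot_embed H ` carrier H)"

definition s_ideal :: "('a, 'b) monoid_scheme \<Rightarrow> 'a set \<Rightarrow> bool" where
  "s_ideal H X \<longleftrightarrow> X \<subseteq> carrier H \<and> X <#>\<^bsub>H\<^esub> carrier H = X"

definition prime_s_ideal :: "('a, 'b) monoid_scheme \<Rightarrow> 'a set \<Rightarrow> bool" where
  "prime_s_ideal H X \<longleftrightarrow> s_ideal H X \<and> X \<noteq> carrier H \<and>
     (\<forall>a\<in>carrier H. \<forall>b\<in>carrier H. a \<otimes>\<^bsub>H\<^esub> b \<in> X \<longrightarrow> a \<in> X \<or> b \<in> X)"

definition minimal_primes :: "('a, 'b) monoid_scheme \<Rightarrow> 'a set set" where
  "minimal_primes H =
     {P. prime_s_ideal H P \<and> P \<noteq> {} \<and>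
         (\<forall>Q. prime_s_ideal H Q \<and> Q \<noteq> {} \<and> Q \<subseteq> P \<longrightarrow> Q = P)}"

definition localization :: "('a, 'b) monoid_scheme \<Rightarrow> 'a set \<Rightarrow> ('a \<times> 'a) set set" where
  "localization H P = {quot H s t | s t. s \<in> carrier H \<and> t \<in> carrier H - P}"

text \<open>The intersection is taken inside the quotient group, so that it is the whole quotient
  group if there are no minimal primes.\<close>

definition weakly_Krull :: "('a, 'b) monoid_scheme \<Rightarrow> bool" where
  "weakly_Krull H \<longleftrightarrow>
     quot_embed H ` carrier H =
       carrier (quot_group H) \<inter> (\<Inter>P\<in>minimal_primes H. localization H P) \<and>
     (\<forall>a\<in>carrier H. finite {P \<in> minimal_primes H. a \<in> P})"


section \<open>Factorizations and arithmetical invariants\<close>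

text \<open>Only for reduced \<open>H\<close> are factorizations multisets of atoms; in general they would be
  multisets of associate classes of atoms.\<close>

definition atoms :: "('a, 'b) monoid_scheme \<Rightarrow> 'a set" where
  "atoms H = {u \<in> carrier H. irreducible H u}"

definition factorizations :: "('a, 'b) monoid_scheme \<Rightarrow> 'a \<Rightarrow> 'a multiset set" where
  "factorizations H a = mset ` {us. set us \<subseteq> carrier H \<and> factors H us a}"

definition length_set :: "('a, 'b) monoid_scheme \<Rightarrow> 'a \<Rightarrow> nat set" where
  "length_set H a = size ` factorizations H a"

definition length_sets :: "('a, 'b) monoid_scheme \<Rightarrow> nat set set" where
  "length_sets H = length_set H ` carrier H"

locale reduced_atomic_monoid = comm_monoid_cancel +
  assumes reduced: "Units G = {\<one>}"
    and atomic: "a \<in> carrier G \<Longrightarrow> factorizations G a \<noteq> {}"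

definition FF_monoid :: "('a, 'b) monoid_scheme \<Rightarrow> bool" where
  "FF_monoid H \<longleftrightarrow> reduced_atomic_monoid H \<and> (\<forall>a\<in>carrier H. finite (factorizations H a))"

definition delta_set :: "nat set \<Rightarrow> nat set" where
  "delta_set L = {d. 1 \<le> d \<and> (\<exists>l\<in>L. L \<inter> {l..l + d} = {l, l + d})}"

definition delta :: "('a, 'b) monoid_scheme \<Rightarrow> nat set" where
  "delta H = (\<Union>L\<in>length_sets H. delta_set L)"

definition unions_of_lengths :: "('a, 'b) monoid_scheme \<Rightarrow> nat \<Rightarrow> nat set" where
  "unions_of_lengths H k = \<Union>{L \<in> length_sets H. k \<in> L}"

definition omega_elem :: "('a, 'b) monoid_scheme \<Rightarrow> 'a \<Rightarrow> enat" where
  "omega_elem H a = (LEAST N::enat. 1 \<le> N \<and>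
     (\<forall>n::nat. \<forall>b \<in> {1..n} \<rightarrow> carrier H. a divides\<^bsub>H\<^esub> finprod H b {1..n} \<longrightarrow>
        (\<exists>\<Omega>. \<Omega> \<subseteq> {1..n} \<and> enat (card \<Omega>) \<le> N \<and> a divides\<^bsub>H\<^esub> finprod H b \<Omega>)))"

definition omega :: "('a, 'b) monoid_scheme \<Rightarrow> enat" where
  "omega H = (SUP u\<in>atoms H. omega_elem H u)"

definition fact_dist :: "'a multiset \<Rightarrow> 'a multiset \<Rightarrow> nat" where
  "fact_dist z z' = max (size z) (size z') - size (z \<inter># z')"

definition tame_degree :: "('a, 'b) monoid_scheme \<Rightarrow> 'a \<Rightarrow> enat" where
  "tame_degree H u = (LEAST N::enat.
     \<forall>a\<in>carrier H. (\<exists>y\<in>factorizations H a. u \<in># y) \<longrightarrow>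
       (\<forall>z\<in>factorizations H a. \<exists>z'\<in>factorizations H a. u \<in># z' \<and> enat (fact_dist z z') \<le> N))"

definition locally_tame :: "('a, 'b) monoid_scheme \<Rightarrow> bool" where
  "locally_tame H \<longleftrightarrow> (\<forall>u\<in>atoms H. tame_degree H u < \<infinity>)"

definition catenary_degree :: "('a, 'b) monoid_scheme \<Rightarrow> enat" where
  "catenary_degree H = (LEAST N::enat.
     \<forall>a\<in>carrier H. \<forall>z\<in>factorizations H a. \<forall>z'\<in>factorizations H a.
       \<exists>(k::nat) f. f 0 = z \<and> f k = z' \<and> (\<forall>i\<le>k. f i \<in> factorizations H a) \<and>
         (\<forall>i\<in>{1..k}. enat (fact_dist (f (i - 1)) (f i)) \<le> N))"


section \<open>Well-definedness of the constructions\<close>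

lemma word_cong_equiv: "equiv UNIV {(u, v). word_cong R u v}"
  by (auto simp: equiv_def refl_on_def sym_def trans_def
      intro: word_cong.refl word_cong.sym word_cong.trans)

lemma presented_group_mult:
  "{w. word_cong R u w} \<otimes>\<^bsub>presented_group R\<^esub> {w. word_cong R v w} = {w. word_cong R (u @ v) w}"
  unfolding presented_group_def
  by (auto intro: word_cong.refl word_cong.trans word_cong.append)

lemma presented_group_carrier:
  "carrier (presented_group R) = range (\<lambda>u. {w. word_cong R u w})"
  by (auto simp: presented_group_def quotient_def)

lemma word_cong_inverse: "word_cong R (rev (map (\<lambda>(x, b). (x, \<not> b)) w) @ w) []"
proof (induction w)
  case Nil
  show ?case by (simp add: word_cong.refl)
next
  case (Cons a w)
  obtain x b where a: "a = (x, b)" by force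
  let ?i = "rev (map (\<lambda>(x, b). (x, \<not> b)) w)"
  have "word_cong R [(x, \<not> b), (x, b)] []"
    using word_cong.cancel[of R x "\<not> b"] by simp
  then have "word_cong R (?i @ ([(x, \<not> b), (x, b)] @ w)) (?i @ ([] @ w))"
    by (intro word_cong.append word_cong.refl)
  then show ?case using Cons a by (auto intro: word_cong.trans)
qed

lemma presented_group_is_group: "group (presented_group R)"
proof (rule groupI)
  have one: "\<one>\<^bsub>presented_group R\<^esub> = {w. word_cong R [] w}"
    by (simp add: presented_group_def)
  fix x assume x: "x \<in> carrier (presented_group R)"
  then obtain u where u: "x = {w. word_cong R u w}" by (auto simp: presented_group_carrier)
  show "\<one>\<^bsub>presented_group R\<^esub> \<otimes>\<^bsub>presented_group R\<^esub> x = x"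
    by (simp add: one u presented_group_mult)
  have "{w. word_cong R (rev (map (\<lambda>(x, b). (x, \<not> b)) u) @ u) w} = {w. word_cong R [] w}"
    using word_cong_inverse word_cong.trans word_cong.sym by blast
  then show "\<exists>y\<in>carrier (presented_group R). y \<otimes>\<^bsub>presented_group R\<^esub> x = \<one>\<^bsub>presented_group R\<^esub>"
    by (auto simp: one u presented_group_carrier presented_group_mult)
next
  show "\<one>\<^bsub>presented_group R\<^esub> \<in> carrier (presented_group R)"
    unfolding presented_group_carrier by (auto simp: presented_group_def)
qed (auto simp: presented_group_carrier presented_group_mult)

lemma (in monoid) foldr_mult_append:
  assumes "set xs \<subseteq> carrier G" "set ys \<subseteq> carrier G"
  shows "foldr (\<otimes>) (xs @ ys) \<one> = foldr (\<otimes>) xs \<one> \<otimes> foldr (\<otimes>) ys \<one>"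
proof -
  have cl: "foldr (\<otimes>) zs \<one> \<in> carrier G" if "set zs \<subseteq> carrier G" for zs
    using that by (induction zs) auto
  show ?thesis using assms by (induction xs) (auto simp: m_assoc cl)
qed

lemma product_one_monoid_comm_monoid_cancel:
  assumes "group G"
  shows "comm_monoid_cancel (product_one_monoid G)"
proof (rule comm_monoid_cancelI, rule comm_monoidI)
  interpret group G by fact
  fix S T
  assume "S \<in> carrier (product_one_monoid G)" "T \<in> carrier (product_one_monoid G)"
  then obtain xs ys where xy: "mset xs = S" "mset ys = T" "set xs \<subseteq> carrier G" "set ys \<subseteq> carrier G"
    "foldr (\<otimes>\<^bsub>G\<^esub>) xs \<one>\<^bsub>G\<^esub> = \<one>\<^bsub>G\<^esub>" "foldr (\<otimes>\<^bsub>G\<^esub>) ys \<one>\<^bsub>G\<^esub> = \<one>\<^bsub>G\<^esub>"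
    by (force simp: product_one_monoid_def sequences_over_def seq_products_def)
  then have "mset (xs @ ys) = S + T" "foldr (\<otimes>\<^bsub>G\<^esub>) (xs @ ys) \<one>\<^bsub>G\<^esub> = \<one>\<^bsub>G\<^esub>"
    using foldr_mult_append[OF xy(3,4)] by auto
  then have "\<one>\<^bsub>G\<^esub> \<in> seq_products G (S + T)"
    unfolding seq_products_def by (metis (mono_tags, lifting) mem_Collect_eq)
  then show "S \<otimes>\<^bsub>product_one_monoid G\<^esub> T \<in> carrier (product_one_monoid G)"
    using xy by (auto simp: product_one_monoid_def sequences_over_def)
qed (auto simp: product_one_monoid_def sequences_over_def seq_products_def add_ac)

lemma product_one_monoid_reduced_atomic:
  assumes "group G"
  shows "reduced_atomic_monoid (product_one_monoid G)"
proof -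
  let ?B = "product_one_monoid G"
  interpret B: comm_monoid_cancel ?B
    by (rule product_one_monoid_comm_monoid_cancel[OF assms])
  have mult: "\<And>S T. S \<otimes>\<^bsub>?B\<^esub> T = S + T" and one: "\<one>\<^bsub>?B\<^esub> = {#}"
    by (auto simp: product_one_monoid_def)
  have units: "Units ?B = {\<one>\<^bsub>?B\<^esub>}"
    using B.one_closed by (auto simp: Units_def mult one)
  have ex: "\<exists>us. set us \<subseteq> carrier ?B \<and> factors ?B us S" if "S \<in> carrier ?B" for S
    using that
  proof (induction "size S" arbitrary: S rule: less_induct)
    case less
    show ?case
    proof (cases "S = {#} \<or> irreducible ?B S")
      case True
      then show ?thesis
      proof
        assume "S = {#}"
        then show ?thesis by (intro exI[of _ "[]"]) (simp add: factors_def one)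
      next
        assume "irreducible ?B S"
        then show ?thesis
          using less.prems by (intro exI[of _ "[S]"]) (simp add: factors_def mult one)
      qed
    next
      case False
      then obtain T where T: "T \<in> carrier ?B" "properfactor ?B T S" "T \<noteq> {#}"
        by (auto simp: irreducible_def units one)
      then obtain U where U: "U \<in> carrier ?B" "S = T + U"
        by (auto simp: properfactor_def factor_def mult)
      have "U \<noteq> {#}"
        using T U less.prems B.one_closed
        by (auto simp: properfactor_def factor_def mult one)
      then have "size T < size S" "size U < size S"
        using T U by (auto simp: nonempty_has_size)
      then obtain ts us where "set ts \<subseteq> carrier ?B" "factors ?B ts T"
        "set us \<subseteq> carrier ?B" "factors ?B us U"
        using less.hyps T U by metis
      then have "set (ts @ us) \<subseteq> carrier ?B \<and> factors ?B (ts @ us) S"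
        using B.foldr_mult_append[of ts us] U by (auto simp: factors_def mult)
      then show ?thesis by blast
    qed
  qed
  show ?thesis
    by unfold_locales (use units ex in \<open>auto simp: factorizations_def\<close>)
qed

context comm_monoid_cancel
begin

lemma quot_rel_equiv: "equiv (carrier G \<times> carrier G) (quot_rel G)"
proof (rule equivI)
  show "trans (quot_rel G)"
  proof (rule transI)
    fix p q r assume "(p, q) \<in> quot_rel G" "(q, r) \<in> quot_rel G"
    moreover obtain a b c d e f where "p = (a, b)" "q = (c, d)" "r = (e, f)"
      by (metis surj_pair)
    ultimately have pqr: "p = (a, b)" "r = (e, f)"
      and cl: "a \<in> carrier G" "b \<in> carrier G" "c \<in> carrier G" "d \<in> carrier G"
        "e \<in> carrier G" "f \<in> carrier G"
      and eq: "a \<otimes> d = c \<otimes> b" "c \<otimes> f = e \<otimes> d"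
      by (auto simp: quot_rel_def)
    have "(a \<otimes> f) \<otimes> d = (a \<otimes> d) \<otimes> f" using cl by (simp add: m_ac)
    also have "\<dots> = (c \<otimes> f) \<otimes> b" using cl eq(1) by (simp add: m_ac)
    also have "\<dots> = (e \<otimes> b) \<otimes> d" using cl eq(2) by (simp add: m_ac)
    finally have "a \<otimes> f = e \<otimes> b" using cl by (meson m_closed r_cancel)
    then show "(p, r) \<in> quot_rel G" using pqr cl by (simp add: quot_rel_def)
  qed
qed (auto simp: quot_rel_def refl_on_def sym_def)

lemma quot_eq_iff:
  assumes "a \<in> carrier G" "b \<in> carrier G" "c \<in> carrier G" "d \<in> carrier G"
  shows "quot G a b = quot G c d \<longleftrightarrow> a \<otimes> d = c \<otimes> b"
  using assms eq_equiv_class_iff[OF quot_rel_equiv, of "(a, b)" "(c, d)"]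
  by (auto simp: quot_def quot_rel_def)

lemma quot_group_carrier:
  "carrier (quot_group G) = {quot G a b | a b. a \<in> carrier G \<and> b \<in> carrier G}"
  by (auto simp: quot_group_def quotient_def quot_def)

lemma quot_group_mult:
  assumes "a \<in> carrier G" "b \<in> carrier G" "c \<in> carrier G" "d \<in> carrier G"
  shows "quot G a b \<otimes>\<^bsub>quot_group G\<^esub> quot G c d = quot G (a \<otimes> c) (b \<otimes> d)"
proof -
  have eq: "quot G (a' \<otimes> c') (b' \<otimes> d') = quot G (a \<otimes> c) (b \<otimes> d)"
    if "(a', b') \<in> quot G a b" "(c', d') \<in> quot G c d" for a' b' c' d'
  proof -
    have cl: "a' \<in> carrier G" "b' \<in> carrier G" "c' \<in> carrier G" "d' \<in> carrier G"
      and e: "a \<otimes> b' = a' \<otimes> b" "c \<otimes> d' = c' \<otimes> d"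
      using that by (auto simp: quot_def quot_rel_def)
    have "(a' \<otimes> c') \<otimes> (b \<otimes> d) = (a' \<otimes> b) \<otimes> (c' \<otimes> d)" using cl assms by (simp add: m_ac)
    also have "\<dots> = (a \<otimes> b') \<otimes> (c \<otimes> d')" by (simp add: e)
    also have "\<dots> = (a \<otimes> c) \<otimes> (b' \<otimes> d')" using cl assms by (simp add: m_ac)
    finally show ?thesis using cl assms by (simp add: quot_eq_iff)
  qed
  have "(a, b) \<in> quot G a b" "(c, d) \<in> quot G c d"
    using assms by (auto simp: quot_def quot_rel_def)
  then have "(\<Union>(a', b')\<in>quot G a b. \<Union>(c', d')\<in>quot G c d. quot G (a' \<otimes> c') (b' \<otimes> d'))
    = quot G (a \<otimes> c) (b \<otimes> d)"
    using eq by blast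
  then show ?thesis by (simp add: quot_group_def)
qed

lemma quot_group_is_comm_group: "comm_group (quot_group G)"
proof (rule comm_groupI)
  have one: "\<one>\<^bsub>quot_group G\<^esub> = quot G \<one> \<one>" by (simp add: quot_group_def)
  show "\<one>\<^bsub>quot_group G\<^esub> \<in> carrier (quot_group G)" by (auto simp: one quot_group_carrier)
  fix x assume "x \<in> carrier (quot_group G)"
  then obtain a b where x: "x = quot G a b" "a \<in> carrier G" "b \<in> carrier G"
    by (auto simp: quot_group_carrier)
  then show "\<one>\<^bsub>quot_group G\<^esub> \<otimes>\<^bsub>quot_group G\<^esub> x = x" by (simp add: one quot_group_mult)
  have "quot G b a \<otimes>\<^bsub>quot_group G\<^esub> x = \<one>\<^bsub>quot_group G\<^esub>"
    using x by (simp add: one quot_group_mult quot_eq_iff m_comm)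
  then show "\<exists>y\<in>carrier (quot_group G). y \<otimes>\<^bsub>quot_group G\<^esub> x = \<one>\<^bsub>quot_group G\<^esub>"
    using x by (auto simp: quot_group_carrier)
qed (auto simp: quot_group_carrier quot_group_mult m_ac, blast)

lemma quot_embed_hom: "quot_embed G \<in> hom G (quot_group G)"
proof (rule homI)
  fix x assume "x \<in> carrier G"
  then show "quot_embed G x \<in> carrier (quot_group G)"
    unfolding quot_embed_def quot_group_carrier using one_closed by blast
qed (simp add: quot_embed_def quot_group_mult)

lemma quot_embed_inj: "inj_on (quot_embed G) (carrier G)"
  by (auto simp: inj_on_def quot_embed_def quot_eq_iff)

end

end

theory Submission
  imports Defs "HOL-Library.Disjoint_Sets" "HOL-Library.FuncSet"
begin

text \<open>
  Everything happens inside sequences built from \<open>\<alpha>\<close> and one or two involutions inverting it.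

  Seminormality fails at \<open>S = \<tau> \<cdot> \<tau>\<alpha> \<cdot> \<alpha>\<^sup>3\<close>: it is not a product-one sequence, but its square and its
  cube are. If \<open>r\<close> is an involution, then every product-one sequence \<open>S\<close> containing \<open>r\<close> satisfies
  \<open>r \<cdot> r | S\<^sup>2\<close>; hence a minimal prime containing \<open>r \<cdot> r\<close> consists of all \<open>S\<close> containing \<open>r\<close>, and
  it omits \<open>s \<cdot> s\<close> for every other involution \<open>s\<close>. Therefore the fraction \<open>\<alpha> \<cdot> \<alpha>\<close> lies in all
  localizations at minimal primes, and the monoid is not weakly Krull.

  To realize a finite nonempty set \<open>L \<subseteq> {2..}\<close> as a set of lengths, consider the grid
  \<open>X = \<Prod>\<^bsub>m\<in>L\<^esub> {0..<m}\<close> and a function \<open>g: X \<rightarrow> \<int>\<close> all of whose fibre sums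
  \<open>\<Sum>{g x | x\<^sub>m = j}\<close> vanish and which is generic otherwise. A subset \<open>T\<close> of \<open>X\<close> has sum zero
  iff its indicator function is a sum of functions of one coordinate each. Since it takes the values
  0 and 1 only, it then depends on one coordinate only. So the minimal zero-sum subsets are the
  fibres, and as fibres in different directions meet, a partition of \<open>X\<close> into fibres uses a single
  direction \<open>m\<close> and has \<open>m\<close> blocks.
\<close>

section \<open>Factorizations into product-one sequences\<close>

lemma size_Suc_0_iff: "size M = Suc 0 \<longleftrightarrow> (\<exists>x. M = {#x#})"
  using size_1_singleton_mset[of M] by auto

context group
begin

abbreviation B :: "'a multiset monoid" where "B \<equiv> product_one_monoid G"

lemma B_mult [simp]: "S \<otimes>\<^bsub>B\<^esub> T = S + T"
  and B_one [simp]: "\<one>\<^bsub>B\<^esub> = {#}"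
  by (simp_all add: product_one_monoid_def)

lemma B_comm_monoid_cancel: "comm_monoid_cancel B"
  using product_one_monoid_comm_monoid_cancel is_group by blast

lemma B_carrierI:
  assumes "set gs \<subseteq> carrier G" "foldr (\<otimes>) gs \<one> = \<one>"
  shows "mset gs \<in> carrier B"
  using assms by (force simp: product_one_monoid_def sequences_over_def seq_products_def)

lemma B_carrierE:
  assumes "S \<in> carrier B"
  obtains gs where "mset gs = S" "set gs \<subseteq> carrier G" "foldr (\<otimes>) gs \<one> = \<one>"
  using assms by (force simp: product_one_monoid_def sequences_over_def seq_products_def)

lemma empty_in_B [simp]: "{#} \<in> carrier B"
  using B_carrierI[of "[]"] by simp

lemma add_in_B [intro]: "S \<in> carrier B \<Longrightarrow> T \<in> carrier B \<Longrightarrow> S + T \<in> carrier B"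
  using monoid.m_closed[of B S T] B_comm_monoid_cancel
  by (simp add: comm_monoid_cancel_def comm_monoid_def)

lemma sum_mset_in_B: "set_mset z \<subseteq> carrier B \<Longrightarrow> \<Sum>\<^sub># z \<in> carrier B"
  by (induction z) auto

lemma finprod_B:
  assumes "finite A" "b \<in> A \<rightarrow> carrier B"
  shows "finprod B b A = sum b A"
proof -
  interpret B: comm_monoid_cancel B by (rule B_comm_monoid_cancel)
  show ?thesis using assms by (induction A) auto
qed

lemma divides_B_iff: "S divides\<^bsub>B\<^esub> T \<longleftrightarrow> (\<exists>U\<in>carrier B. T = S + U)"
  by (simp add: factor_def)

lemma Units_B: "Units B = {{#}}"
  using empty_in_B by (auto simp: Units_def)

lemma atoms_B_iff:
  "u \<in> atoms B \<longleftrightarrow> u \<in> carrier B \<and> u \<noteq> {#} \<and>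
     (\<forall>S\<in>carrier B. \<forall>T\<in>carrier B. u = S + T \<longrightarrow> S = {#} \<or> T = {#})"
  (is "_ \<longleftrightarrow> ?R")
proof
  assume "u \<in> atoms B"
  then have u: "u \<in> carrier B" "u \<noteq> {#}"
    and *: "\<And>S. S \<in> carrier B \<Longrightarrow> properfactor B S u \<Longrightarrow> S = {#}"
    by (auto simp: atoms_def irreducible_def Units_B)
  have "S = {#} \<or> T = {#}" if "S \<in> carrier B" "T \<in> carrier B" "u = S + T" for S T
    using *[of S] that by (auto simp: properfactor_def divides_B_iff)
  then show ?R using u by blast
next
  assume u: ?R
  have "S = {#}" if "S \<in> carrier B" "properfactor B S u" for S
  proof -
    have "S divides\<^bsub>B\<^esub> u" and nd: "\<not> u divides\<^bsub>B\<^esub> S"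
      using that(2) by (simp_all add: properfactor_def)
    then obtain U where "U \<in> carrier B" "u = S + U"
      unfolding divides_B_iff by blast
    moreover from this nd have "U \<noteq> {#}" using u by (auto simp: divides_B_iff)
    ultimately show ?thesis using u that(1) by blast
  qed
  then show "u \<in> atoms B"
    using u by (auto simp: atoms_def irreducible_def Units_B)
qed

lemma factorizations_B_iff:
  "z \<in> factorizations B S \<longleftrightarrow> set_mset z \<subseteq> atoms B \<and> \<Sum>\<^sub># z = S"
proof -
  have fold: "foldr (\<otimes>\<^bsub>B\<^esub>) us {#} = \<Sum>\<^sub># (mset us)" for us
    by (induction us) auto
  obtain us where us: "mset us = z" by (metis ex_mset)
  show ?thesis
  proof
    assume "z \<in> factorizations B S"
    then show "set_mset z \<subseteq> atoms B \<and> \<Sum>\<^sub># z = S"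
      by (auto simp: factorizations_def factors_def fold atoms_def)
  next
    assume "set_mset z \<subseteq> atoms B \<and> \<Sum>\<^sub># z = S"
    then show "z \<in> factorizations B S"
      unfolding factorizations_def factors_def B_one fold using us
      by (auto simp: atoms_def intro!: image_eqI[of _ _ us])
  qed
qed

lemma atom_in_B: "u \<in> atoms B \<Longrightarrow> u \<in> carrier B"
  and atom_nonempty: "u \<in> atoms B \<Longrightarrow> u \<noteq> {#}"
  by (simp_all add: atoms_B_iff)

lemma factorizations_B_nonempty: "S \<in> carrier B \<Longrightarrow> factorizations B S \<noteq> {}"
  by (rule reduced_atomic_monoid.atomic[OF product_one_monoid_reduced_atomic[OF is_group]])

lemma length_setE:
  assumes "n \<in> length_set H a"
  obtains z where "z \<in> factorizations H a" "size z = n"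
  using assms by (auto simp: length_set_def)

lemma length_factorization_atom:
  assumes "u \<in> atoms B" "z \<in> factorizations B u"
  shows "size z = 1"
proof -
  have z: "set_mset z \<subseteq> atoms B" "\<Sum>\<^sub># z = u" using assms by (auto simp: factorizations_B_iff)
  have "z \<noteq> {#}" using z assms by (auto simp: atoms_B_iff)
  then obtain v z' where v: "z = add_mset v z'" by (metis multiset_cases)
  have atoms: "v \<in> atoms B" "set_mset z' \<subseteq> atoms B" using z v by auto
  then have "\<Sum>\<^sub># z' \<in> carrier B" using atom_in_B by (intro sum_mset_in_B) blast
  moreover have "u = v + \<Sum>\<^sub># z'" using z v by simp
  ultimately have "\<Sum>\<^sub># z' = {#}"
    using assms(1) atoms(1) unfolding atoms_B_iff by blast
  then have "z' = {#}"
    using atoms(2) atom_nonempty by (cases z') auto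
  then show ?thesis by (simp add: v)
qed

text \<open>Atoms are nonempty, so a factorization of \<open>S\<close> has at most
  \<open>size S\<close> factors, each one of the finitely many submultisets of
  \<open>S\<close>.\<close>

lemma finite_factorizations_B: "finite (factorizations B S)"
proof -
  have size: "size z \<le> size (\<Sum>\<^sub># z)" if "set_mset z \<subseteq> atoms B" for z
    using that
  proof (induction z)
    case (add u z)
    then have "size u > 0" by (auto simp: atoms_B_iff nonempty_has_size)
    then show ?case using add by auto
  qed auto
  have sub: "v \<subseteq># \<Sum>\<^sub># z" if "v \<in># z" for v and z :: "'a multiset multiset"
    using that by (metis insert_DiffM mset_subset_eq_add_left sum_mset.add_mset)
  have fin: "finite {v. v \<subseteq># S}"
  proof (rule finite_subset)
    show "{v. v \<subseteq># S} \<subseteq> (\<Union>n\<le>size S. multisets_of_size (set_mset S) n)"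
      using size_mset_mono set_mset_mono by (fastforce simp: multisets_of_size_def)
  qed auto
  have "factorizations B S \<subseteq> (\<Union>n\<le>size S. multisets_of_size {v. v \<subseteq># S} n)"
    using size sub by (auto simp: factorizations_B_iff multisets_of_size_def)
  then show ?thesis
    by (rule finite_subset) (use fin in auto)
qed

lemma FF_monoid_B: "FF_monoid B"
  unfolding FF_monoid_def
  using product_one_monoid_reduced_atomic[OF is_group] finite_factorizations_B by blast

text \<open>One inclusion of the description of all sets of lengths, valid over every group: length
  0 occurs only for the empty sequence, length 1 only for atoms, and these have no other
  length.\<close>

lemma length_set_B_cases:
  assumes "S \<in> carrier B"
  shows "length_set B S \<subseteq> {2..} \<and> finite (length_set B S) \<and> length_set B S \<noteq> {}
    \<or> length_set B S = {0} \<or> length_set B S = {1}"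
proof -
  have ne: "length_set B S \<noteq> {}" and fin: "finite (length_set B S)"
    using factorizations_B_nonempty[OF assms] finite_factorizations_B by (auto simp: length_set_def)
  consider "0 \<in> length_set B S" | "1 \<in> length_set B S"
    | "0 \<notin> length_set B S" "1 \<notin> length_set B S" by blast
  then show ?thesis
  proof cases
    case 1
    then have "S = {#}" by (auto simp: length_set_def factorizations_B_iff)
    then have "z = {#}" if "z \<in> factorizations B S" for z
      using that atom_nonempty by (cases z) (auto simp: factorizations_B_iff)
    then have "length_set B S \<subseteq> {0}" by (auto simp: length_set_def)
    then show ?thesis using ne by blast
  next
    case 2
    then have "S \<in> atoms B"
      by (auto elim!: length_setE simp: factorizations_B_iff size_Suc_0_iff)
    then have "length_set B S \<subseteq> {1}"
      using length_factorization_atom by (auto simp: length_set_def)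
    then show ?thesis using ne by blast
  next
    case 3
    then have "n \<ge> 2" if "n \<in> length_set B S" for n
      using that by (cases "n = 0"; cases "n = 1") auto
    then show ?thesis using ne fin by auto
  qed
qed

lemma length_set_empty: "length_set B {#} = {0}"
proof -
  have "{#} \<in> factorizations B {#}" by (simp add: factorizations_B_iff)
  then have "0 \<in> length_set B {#}" by (force simp: length_set_def)
  then show ?thesis using length_set_B_cases[of "{#}"] by auto
qed

lemma length_set_one: "length_set B {#\<one>#} = {1}"
proof -
  have "{#\<one>#} \<in> carrier B" using B_carrierI[of "[\<one>]"] by simp
  then have "{#\<one>#} \<in> atoms B" by (auto simp: atoms_B_iff single_is_union)
  then have "{#{#\<one>#}#} \<in> factorizations B {#\<one>#}" by (simp add: factorizations_B_iff)
  then have "1 \<in> length_set B {#\<one>#}" by (force simp: length_set_def)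
  then show ?thesis using length_set_B_cases[OF \<open>{#\<one>#} \<in> carrier B\<close>] by auto
qed

section \<open>Consequences of two-element length sets\<close>

text \<open>A chain from length 2 to length \<open>n\<close> must jump directly between these two
  lengths, and the gcd of the factorizations at the jump has size at most 2.\<close>

lemma catenary_degree_B_infinite:
  assumes "\<And>n. n \<ge> 3 \<Longrightarrow> \<exists>S\<in>carrier B. length_set B S = {2, n}"
  shows "catenary_degree B = \<infinity>"
proof -
  let ?P = "\<lambda>N::enat. \<forall>a\<in>carrier B. \<forall>z\<in>factorizations B a. \<forall>z'\<in>factorizations B a.
       \<exists>(k::nat) f. f 0 = z \<and> f k = z' \<and> (\<forall>i\<le>k. f i \<in> factorizations B a) \<and>
         (\<forall>i\<in>{1..k}. enat (fact_dist (f (i - 1)) (f i)) \<le> N)"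
  \<comment> \<open>\<open>LEAST\<close> over \<open>enat\<close> is a true minimum once some value
    qualifies; infinity always does.\<close>
  have "?P \<infinity>"
  proof (intro ballI)
    fix a z z' assume "z \<in> factorizations B a" "z' \<in> factorizations B a"
    then show "\<exists>(k::nat) f. f 0 = z \<and> f k = z' \<and> (\<forall>i\<le>k. f i \<in> factorizations B a) \<and>
         (\<forall>i\<in>{1..k}. enat (fact_dist (f (i - 1)) (f i)) \<le> \<infinity>)"
      by (intro exI[of _ 1] exI[of _ "\<lambda>i. if i = 0 then z else z'"]) auto
  qed
  then have least: "?P (catenary_degree B)"
    unfolding catenary_degree_def by (rule LeastI)
  show ?thesis
  proof (rule ccontr)
    assume "catenary_degree B \<noteq> \<infinity>"
    then obtain N :: nat where N: "catenary_degree B = enat N" by blast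
    \<comment> \<open>A jump from length 2 to length \<open>N + 3\<close> has distance at least
      \<open>N + 1\<close>.\<close>
    obtain a where a: "a \<in> carrier B" "length_set B a = {2, N + 3}"
      using assms[of "N + 3"] by auto
    have "2 \<in> length_set B a" "N + 3 \<in> length_set B a" using a by auto
    then obtain z z' where z: "z \<in> factorizations B a" "size z = 2"
      "z' \<in> factorizations B a" "size z' = N + 3"
      by (auto elim!: length_setE)
    have "\<exists>(k::nat) f. f 0 = z \<and> f k = z' \<and> (\<forall>i\<le>k. f i \<in> factorizations B a) \<and>
         (\<forall>i\<in>{1..k}. enat (fact_dist (f (i - 1)) (f i)) \<le> enat N)"
      using least a(1) z(1,3) unfolding N by blast
    then obtain k :: nat and f where f: "f 0 = z" "f k = z'" "\<forall>i\<le>k. f i \<in> factorizations B a"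
      "\<forall>i\<in>{1..k}. fact_dist (f (i - 1)) (f i) \<le> N"
      unfolding enat_ord_simps by blast
    have "size (f i) = 2" if "i \<le> k" for i
      using that
    proof (induction i)
      case (Suc i)
      have "size (f i \<inter># f (Suc i)) \<le> size (f i)" by (simp add: size_mset_mono)
      then have "size (f (Suc i)) \<noteq> N + 3"
        using Suc f(4)[rule_format, of "Suc i"] by (auto simp: fact_dist_def)
      moreover have "size (f (Suc i)) \<in> length_set B a"
        using f(3) Suc by (auto simp: length_set_def)
      ultimately show ?case using a by auto
    qed (use f z in auto)
    then show False using f(2) z by force
  qed
qed

text \<open>If \<open>a = u\<^sub>1 u\<^sub>2 = v\<^sub>1 \<dots> v\<^sub>n\<close> with atoms \<open>u\<^sub>i\<close> and \<open>v\<^sub>j\<close>, then \<open>u\<^sub>1\<close> divides no proper subproduct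
  of the \<open>v\<^sub>j\<close>, as the cofactor of such a subproduct would divide the atom \<open>u\<^sub>2\<close>.\<close>

lemma omega_B_infinite:
  assumes "\<And>n. n \<ge> 3 \<Longrightarrow> \<exists>S\<in>carrier B. length_set B S = {2, n}"
  shows "omega B = \<infinity>"
proof -
  have "\<exists>u\<in>atoms B. omega_elem B u > enat N" for N
  proof -
    define n where "n = N + 3"
    obtain a where a: "a \<in> carrier B" "length_set B a = {2, n}"
      using assms[of n] by (auto simp: n_def)
    have "2 \<in> length_set B a" "n \<in> length_set B a" using a by auto
    then obtain y z where y: "y \<in> factorizations B a" "size y = 2"
      and z: "z \<in> factorizations B a" "size z = n"
      by (auto elim!: length_setE)
    then obtain u u' where u: "y = {#u, u'#}"
      by (auto simp: numeral_2_eq_2 size_Suc_0_iff elim!: size_mset_SucE)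
    then have uat: "u \<in> atoms B" "u' \<in> atoms B" and au: "a = u + u'"
      using y by (auto simp: factorizations_B_iff)
    obtain vs where vs: "mset vs = z" by (metis ex_mset)
    \<comment> \<open>The shift matches the index set \<open>{1..n}\<close> of
      \<open>omega_elem\<close> with list positions counted from 0.\<close>
    define b where "b i = vs ! (i - 1)" for i
    have len: "length vs = n" using vs z by auto
    have b_atom: "b i \<in> atoms B" if "i \<in> {1..n}" for i
      using that z vs len unfolding b_def factorizations_B_iff
      by (metis One_nat_def Suc_pred atLeastAtMost_iff less_eq_Suc_le nth_mem_mset subsetD)
    have "{#b i. i \<in># mset_set {1..n}#} = z"
    proof -
      have "mset_set {1..n} = image_mset Suc (mset_set {0..<n})"
        by (simp add: image_mset_mset_set flip: image_Suc_atLeastLessThan atLeastLessThanSuc_atLeastAtMost)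
      then have "{#b i. i \<in># mset_set {1..n}#} = image_mset (\<lambda>i. vs ! i) (mset_set {0..<n})"
        by (simp add: b_def image_mset.compositionality comp_def)
      also have "\<dots> = mset (map (\<lambda>i. vs ! i) [0..<n])" by simp
      also have "map (\<lambda>i. vs ! i) [0..<n] = vs" using len map_nth by blast
      finally show ?thesis using vs by simp
    qed
    then have suma: "sum b {1..n} = a"
      using z by (simp add: factorizations_B_iff sum_unfold_sum_mset)
    have sub_fact: "image_mset b (mset_set A) \<in> factorizations B (sum b A)" if "A \<subseteq> {1..n}" for A
      using that b_atom finite_subset[OF that]
      by (auto simp: factorizations_B_iff sum_unfold_sum_mset)
    let ?P = "\<lambda>N::enat. 1 \<le> N \<and> (\<forall>n::nat. \<forall>b \<in> {1..n} \<rightarrow> carrier B. u divides\<^bsub>B\<^esub> finprod B b {1..n} \<longrightarrow>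
        (\<exists>\<Omega>. \<Omega> \<subseteq> {1..n} \<and> enat (card \<Omega>) \<le> N \<and> u divides\<^bsub>B\<^esub> finprod B b \<Omega>))"
    have "?P \<infinity>" by auto
    then have least: "?P (omega_elem B u)"
      unfolding omega_elem_def by (rule LeastI)
    have bcl: "b \<in> {1..n} \<rightarrow> carrier B" using b_atom atom_in_B by auto
    moreover have "u divides\<^bsub>B\<^esub> finprod B b {1..n}"
      using bcl suma au uat atom_in_B by (auto simp: finprod_B divides_B_iff)
    ultimately obtain \<Omega> where \<Omega>: "\<Omega> \<subseteq> {1..n}" "enat (card \<Omega>) \<le> omega_elem B u"
      "u divides\<^bsub>B\<^esub> finprod B b \<Omega>"
      using least by blast
    have fin\<Omega>: "finite \<Omega>" using \<Omega> finite_subset by blast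
    have "b \<in> \<Omega> \<rightarrow> carrier B" using bcl \<Omega>(1) by blast
    then obtain w where w: "w \<in> carrier B" "sum b \<Omega> = u + w"
      using \<Omega>(3) by (auto simp: finprod_B fin\<Omega> divides_B_iff)
    have "\<Omega> = {1..n}"
    proof (rule ccontr)
      assume "\<Omega> \<noteq> {1..n}"
      let ?R = "{1..n} - \<Omega>"
      have ne: "?R \<noteq> {}" using \<Omega>(1) \<open>\<Omega> \<noteq> {1..n}\<close> by blast
      have "a = sum b \<Omega> + sum b ?R"
        using suma sum.subset_diff[OF \<Omega>(1), of b] by (simp add: add.commute)
      then have u': "u' = w + sum b ?R" using w au by (simp add: add.assoc)
      obtain y' where y': "y' \<in> factorizations B w" using factorizations_B_nonempty[OF w(1)] by blast
      \<comment> \<open>The atom \<open>u'\<close> is \<open>w\<close> times the omitted factors. So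
        exactly one factor is omitted and \<open>w\<close> is empty, which makes the atom
        \<open>u\<close> a product of \<open>n - 1\<close> \<ge> 2 atoms.\<close>
      have "y' + image_mset b (mset_set ?R) \<in> factorizations B u'"
        using sub_fact[of ?R] y' u' by (auto simp: factorizations_B_iff)
      then have "size (y' + image_mset b (mset_set ?R)) = 1"
        using length_factorization_atom uat by blast
      then have 1: "size y' + card ?R = 1" by simp
      have "card ?R > 0" using ne by (simp add: card_gt_0_iff)
      then have "size y' = 0" and card1: "card ?R = 1" using 1 by linarith+
      then have "y' = {#}" by simp
      then have "w = {#}" using y' by (simp add: factorizations_B_iff)
      then have "image_mset b (mset_set \<Omega>) \<in> factorizations B u"
        using sub_fact[OF \<Omega>(1)] w by simp
      then have "card \<Omega> = 1"
        using length_factorization_atom[OF uat(1)] by fastforce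
      moreover have "card ?R = n - card \<Omega>" using \<Omega>(1) fin\<Omega> by (simp add: card_Diff_subset)
      ultimately show False using card1 by (simp add: n_def)
    qed
    then have "enat n \<le> omega_elem B u" using \<Omega>(2) by simp
    then have "omega_elem B u > enat N"
      using less_le_trans[of "enat N" "enat n"] by (simp add: n_def)
    then show ?thesis using uat by blast
  qed
  then have "omega B > enat N" for N
    unfolding omega_def less_SUP_iff by blast
  then show ?thesis by (metis enat.exhaust less_irrefl)
qed

end

section \<open>Zero-sum subsets of a grid\<close>

text \<open>The coefficients are powers of \<open>M\<close>, as in a positional system: reduction
  modulo \<open>M\<close> shows that the digit at \<open>s0\<close> vanishes, and division by
  \<open>M\<close> leaves the smaller index set.\<close>

lemma generic_coefficients:
  fixes M :: int
  assumes "finite S"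
  shows "\<exists>c :: 's \<Rightarrow> int. \<forall>\<phi>. (\<forall>s\<in>S. \<bar>\<phi> s\<bar> < M) \<longrightarrow> (\<Sum>s\<in>S. c s * \<phi> s) = 0 \<longrightarrow> (\<forall>s\<in>S. \<phi> s = 0)"
  using assms
proof (induction S)
  case (insert s0 S)
  then obtain c :: "'s \<Rightarrow> int"
    where c: "\<And>\<phi>. \<forall>s\<in>S. \<bar>\<phi> s\<bar> < M \<Longrightarrow> (\<Sum>s\<in>S. c s * \<phi> s) = 0 \<Longrightarrow> \<forall>s\<in>S. \<phi> s = 0"
    by metis
  define c' where "c' s = (if s = s0 then 1 else M * c s)" for s
  have "\<forall>s\<in>insert s0 S. \<phi> s = 0"
    if \<phi>: "\<forall>s\<in>insert s0 S. \<bar>\<phi> s\<bar> < M" "(\<Sum>s\<in>insert s0 S. c' s * \<phi> s) = 0" for \<phi>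
  proof -
    have "(\<Sum>s\<in>S. c' s * \<phi> s) = (\<Sum>s\<in>S. M * (c s * \<phi> s))"
      using insert.hyps by (intro sum.cong) (auto simp: c'_def)
    then have eq: "\<phi> s0 + M * (\<Sum>s\<in>S. c s * \<phi> s) = 0"
      using \<phi>(2) insert.hyps by (simp add: c'_def sum_distrib_left)
    then have "\<phi> s0 = M * - (\<Sum>s\<in>S. c s * \<phi> s)" by simp
    then have "M dvd \<phi> s0" by (rule dvdI)
    then have "\<phi> s0 = 0"
      using \<phi>(1) zdvd_not_zless[of "\<bar>\<phi> s0\<bar>" M] by force
    moreover have "M \<noteq> 0" using \<phi>(1) by auto
    ultimately have "(\<Sum>s\<in>S. c s * \<phi> s) = 0" using eq by simp
    then have "\<forall>s\<in>S. \<phi> s = 0" using \<phi>(1) by (intro c) auto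
    then show ?thesis using \<open>\<phi> s0 = 0\<close> by blast
  qed
  then show ?case by blast
qed auto

locale grid =
  fixes L :: "nat set"
  assumes fin: "finite L" and ne: "L \<noteq> {}" and ge2: "L \<subseteq> {2..}"
begin

text \<open>The number \<open>m\<close> is both the name of a direction and the number of fibres in
  that direction.\<close>

definition X :: "(nat \<Rightarrow> nat) set" where
  "X = (\<Pi>\<^sub>E m\<in>L. {..<m})"

definition fibre :: "nat \<Rightarrow> nat \<Rightarrow> (nat \<Rightarrow> nat) set" where
  "fibre m j = {x \<in> X. x m = j}"

definition cylinder :: "nat \<Rightarrow> (nat \<Rightarrow> nat) set \<Rightarrow> bool" where
  "cylinder m T \<longleftrightarrow> (\<forall>x\<in>X. \<forall>y\<in>X. x m = y m \<longrightarrow> (x \<in> T \<longleftrightarrow> y \<in> T))"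

text \<open>A function that is a sum of functions of one coordinate each keeps its total over two
  points when these exchange a coordinate. The defect measures the failure of this for the indicator
  of \<open>T\<close>; it is additive over disjoint unions.\<close>

definition swap_defect :: "(nat \<Rightarrow> nat) set \<Rightarrow> (nat \<Rightarrow> nat) \<times> (nat \<Rightarrow> nat) \<times> nat \<Rightarrow> int" where
  "swap_defect T = (\<lambda>(x, w, m). of_bool (x \<in> T) + of_bool (w \<in> T)
     - of_bool (x(m := w m) \<in> T) - of_bool (w(m := x m) \<in> T))"

lemma finite_X: "finite X"
  using fin by (auto simp: X_def intro: finite_PiE)

lemma X_upd: "x \<in> X \<Longrightarrow> m \<in> L \<Longrightarrow> b < m \<Longrightarrow> x(m := b) \<in> X"
  by (auto simp: X_def PiE_iff extensional_def)

lemma X_less: "x \<in> X \<Longrightarrow> m \<in> L \<Longrightarrow> x m < m"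
  by (auto simp: X_def)

lemma ex_in_X:
  assumes "m \<in> L" "j < m" "m' \<in> L" "j' < m'" "m \<noteq> m'"
  shows "\<exists>x\<in>X. x m = j \<and> x m' = j'"
proof
  \<comment> \<open>The default 0 is admissible because all elements of \<open>L\<close> are
    positive.\<close>
  show "(\<lambda>k\<in>L. if k = m then j else if k = m' then j' else 0) \<in> X"
    using assms ge2 by (force simp: X_def)
qed (use assms in auto)

lemma ex_in_fibre:
  assumes "m \<in> L" "j < m"
  shows "\<exists>x\<in>X. x m = j"
proof
  show "(\<lambda>k\<in>L. if k = m then j else 0) \<in> X"
    using assms ge2 by (force simp: X_def)
qed (use assms in auto)

lemma fibre_subset_X: "fibre m j \<subseteq> X"
  by (auto simp: fibre_def)

lemma fibre_nonempty: "m \<in> L \<Longrightarrow> j < m \<Longrightarrow> fibre m j \<noteq> {}"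
  using ex_in_fibre by (fastforce simp: fibre_def)

text \<open>Every direction has at least two fibres, and a fibre in another direction meets all of
  them, so it is contained in none.\<close>

lemma fibre_subset_fibreD:
  assumes "m \<in> L" "j < m" "m' \<in> L" "j' < m'" "fibre m' j' \<subseteq> fibre m j"
  shows "m' = m \<and> j' = j"
proof -
  have "m' = m"
  proof (rule ccontr)
    assume "m' \<noteq> m"
    define i :: nat where "i = (if j = 0 then 1 else 0)"
    have "i < m" "i \<noteq> j" using assms(1) ge2 by (auto simp: i_def)
    then obtain x where "x \<in> X" "x m' = j'" "x m = i"
      using ex_in_X[OF assms(3,4,1) _ \<open>m' \<noteq> m\<close>] by blast
    then show False using assms(5) \<open>i \<noteq> j\<close> by (auto simp: fibre_def)
  qed
  then show ?thesis using assms(5) ex_in_fibre[OF assms(3,4)] by (auto simp: fibre_def)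
qed

text \<open>The swap exchanges the two membership values if \<open>k = m\<close> and preserves each
  of them otherwise.\<close>

lemma swap_defect_cylinder:
  assumes "cylinder k T" "k \<in> L" "x \<in> X" "w \<in> X" "m \<in> L"
  shows "swap_defect T (x, w, m) = 0"
proof -
  have X': "x(m := w m) \<in> X" "w(m := x m) \<in> X" using assms X_upd X_less by auto
  show ?thesis
  proof (cases "k = m")
    case True
    then have "x(m := w m) \<in> T \<longleftrightarrow> w \<in> T" "w(m := x m) \<in> T \<longleftrightarrow> x \<in> T"
      using assms(1,3,4) X' unfolding cylinder_def by (metis fun_upd_same)+
    then show ?thesis by (simp add: swap_defect_def)
  next
    case False
    then have "(x(m := w m)) k = x k" "(w(m := x m)) k = w k" by auto
    then have "x(m := w m) \<in> T \<longleftrightarrow> x \<in> T" "w(m := x m) \<in> T \<longleftrightarrow> w \<in> T"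
      using assms X' unfolding cylinder_def by blast+
    then show ?thesis by (simp add: swap_defect_def)
  qed
qed

text \<open>Changing the coordinate \<open>m\<close> from \<open>a\<close> to \<open>b\<close> changes the indicator function of \<open>T\<close> by an
  amount that does not depend on the point. If this amount is \<open>-1\<close>, the indicator function has to
  be \<open>1\<close> wherever the coordinate \<open>m\<close> is \<open>a\<close>, and hence no other coordinate can influence it.\<close>

lemma cylinder_of_swap_defect:
  assumes defect: "\<And>x w m. x \<in> X \<Longrightarrow> w \<in> X \<Longrightarrow> m \<in> L \<Longrightarrow> swap_defect T (x, w, m) = 0"
  shows "\<exists>m\<in>L. cylinder m T"
proof (cases "\<exists>x\<in>X. \<exists>m\<in>L. \<exists>b<m. x \<in> T \<and> x(m := b) \<notin> T")
  case True
  then obtain x m b where x: "x \<in> X" "m \<in> L" "b < m" "x \<in> T" "x(m := b) \<notin> T" by blast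
  have all: "w(m := x m) \<in> T" if w: "w \<in> X" for w
  proof -
    have "w(m := b) \<in> X" using x w X_upd by blast
    \<comment> \<open>The swap equation reads 1 + [\<open>w(m := b) \<in> T\<close>] = 0 +
      [\<open>w(m := x m) \<in> T\<close>].\<close>
    from defect[OF x(1) this x(2)] show ?thesis
      using x by (auto simp: swap_defect_def of_bool_def split: if_splits)
  qed
  have "p \<in> T \<longleftrightarrow> q \<in> T" if pq: "p \<in> X" "q \<in> X" "p m = q m" for p q
  proof -
    have "q(m := x m) \<in> X" using X_upd X_less x pq by blast
    \<comment> \<open>By \<open>all\<close>, the points with coordinate \<open>x m\<close>
      contribute 1 on either side; what remains compares \<open>p\<close> with
      \<open>q\<close>.\<close>
    from defect[OF pq(1) this x(2)] show ?thesis
      using all[OF pq(1)] all[OF pq(2)] pq(3) by (auto simp: swap_defect_def)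
  qed
  then show ?thesis using x(2) unfolding cylinder_def by blast
next
  case False
  \<comment> \<open>Changes leading out of \<open>T\<close> are excluded, and undoing a change into
    \<open>T\<close> would be one.\<close>
  have step: "x(m := b) \<in> T \<longleftrightarrow> x \<in> T" if "x \<in> X" "m \<in> L" "b < m" for x m b
  proof -
    have "x(m := b) \<in> X" "x m < m" "(x(m := b))(m := x m) = x" using that X_upd X_less by auto
    then show ?thesis using False that by metis
  qed
  have const: "x \<in> T \<longleftrightarrow> y \<in> T" if xy: "x \<in> X" "y \<in> X" for x y
  proof -
    have "override_on x y A \<in> X \<and> (override_on x y A \<in> T \<longleftrightarrow> x \<in> T)" if "A \<subseteq> L" "finite A" for A
      using that(2,1)
    proof (induction A)
      case (insert m A)
      then show ?case
        using X_upd[of "override_on x y A" m "y m"] step[of "override_on x y A" m "y m"]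
          X_less[OF xy(2), of m] unfolding override_on_insert by blast
    qed (use xy in auto)
    from this[of L] have "override_on x y L \<in> T \<longleftrightarrow> x \<in> T" using fin by auto
    moreover have "override_on x y L = y"
      using xy by (auto simp: override_on_def X_def PiE_iff extensional_def fun_eq_iff)
    ultimately show ?thesis by simp
  qed
  have "cylinder m T" for m unfolding cylinder_def using const by blast
  then show ?thesis using ne by blast
qed

text \<open>The weight of a point is a generic combination of the swap defects of its singleton. By
  additivity \<open>sum g T\<close> is the same combination of the defects of \<open>T\<close>;
  these lie between -2 and 2, so the sum vanishes only if all of them do.\<close>

lemma ex_grid_weights:
  "\<exists>g :: (nat \<Rightarrow> nat) \<Rightarrow> int. \<forall>T\<subseteq>X. sum g T = 0 \<longleftrightarrow> (\<exists>m\<in>L. cylinder m T)"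
proof -
  let ?S = "X \<times> X \<times> L"
  have "finite ?S" using finite_X fin by auto
  from generic_coefficients[OF this, of 3] obtain c :: "(nat \<Rightarrow> nat) \<times> (nat \<Rightarrow> nat) \<times> nat \<Rightarrow> int"
    where c: "\<forall>\<phi>. (\<forall>s\<in>?S. \<bar>\<phi> s\<bar> < 3) \<longrightarrow> (\<Sum>s\<in>?S. c s * \<phi> s) = 0 \<longrightarrow> (\<forall>s\<in>?S. \<phi> s = 0)"
    by (elim exE)
  define g where "g y = (\<Sum>s\<in>?S. c s * swap_defect {y} s)" for y
  have sumg: "sum g T = (\<Sum>s\<in>?S. c s * swap_defect T s)" if "T \<subseteq> X" for T
  proof -
    have T: "finite T" using that finite_X finite_subset by blast
    have "(\<Sum>y\<in>T. swap_defect {y} s) = swap_defect T s" for s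
      using T by (cases s) (simp add: swap_defect_def sum_subtractf sum.distrib of_bool_def)
    then have "(\<Sum>s\<in>?S. c s * swap_defect T s) = (\<Sum>s\<in>?S. \<Sum>y\<in>T. c s * swap_defect {y} s)"
      by (simp flip: sum_distrib_left)
    also have "\<dots> = sum g T" unfolding g_def by (rule sum.swap)
    finally show ?thesis by simp
  qed
  have "sum g T = 0 \<longleftrightarrow> (\<exists>m\<in>L. cylinder m T)" if T: "T \<subseteq> X" for T
  proof
    have "\<forall>s\<in>?S. \<bar>swap_defect T s\<bar> < 3" by (auto simp: swap_defect_def of_bool_def)
    moreover assume "sum g T = 0"
    ultimately have "\<forall>s\<in>?S. swap_defect T s = 0"
      using c[THEN spec, of "swap_defect T"] sumg[OF T] by presburger
    then show "\<exists>m\<in>L. cylinder m T" by (intro cylinder_of_swap_defect) auto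
  next
    assume "\<exists>m\<in>L. cylinder m T"
    then have "swap_defect T s = 0" if "s \<in> ?S" for s
      using that swap_defect_cylinder by auto
    then show "sum g T = 0" using sumg[OF T] by simp
  qed
  then show ?thesis by blast
qed

lemma cylinder_fibre: "cylinder m (fibre m j)"
  by (auto simp: cylinder_def fibre_def)

lemma fibre_subset_cylinder:
  assumes "T \<subseteq> X" "T \<noteq> {}" "m \<in> L" "cylinder m T"
  shows "\<exists>j<m. fibre m j \<subseteq> T"
proof -
  obtain x where "x \<in> T" using assms by blast
  then have "x m < m" using assms X_less by blast
  moreover have "fibre m (x m) \<subseteq> T"
  proof
    fix y assume "y \<in> fibre m (x m)"
    then have "y \<in> X" "y m = x m" by (simp_all add: fibre_def)
    then show "y \<in> T" using \<open>x \<in> T\<close> assms(1,4) unfolding cylinder_def by blast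
  qed
  ultimately show ?thesis by blast
qed

text \<open>Blocks in different directions would meet without being equal, and covering
  \<open>X\<close> in a single direction takes all fibres of that direction.\<close>

lemma partition_on_fibres:
  assumes P: "partition_on X P" and fibres: "\<And>T. T \<in> P \<Longrightarrow> \<exists>m\<in>L. \<exists>j<m. T = fibre m j"
  shows "\<exists>m\<in>L. P = fibre m ` {..<m}"
proof -
  obtain m0 where "m0 \<in> L" using ne by blast
  then have "X \<noteq> {}" using fibre_nonempty[of m0 0] ge2 fibre_subset_X by fastforce
  then obtain T where "T \<in> P" using P by (auto simp: partition_on_def)
  with fibres obtain m j where m: "m \<in> L" "j < m" "fibre m j \<in> P" by blast
  have in_dir: "\<exists>j'<m. T = fibre m j'" if TP: "T \<in> P" for T
  proof -
    obtain m' j' where m': "m' \<in> L" "j' < m'" "T = fibre m' j'" using fibres[OF TP] by blast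
    have "m' = m"
    proof (rule ccontr)
      assume "m' \<noteq> m"
      then obtain x where "x \<in> X" "x m' = j'" "x m = j"
        using ex_in_X[OF m'(1,2) m(1,2)] by blast
      then have x: "x \<in> T" "x \<in> fibre m j" using m' by (auto simp: fibre_def)
      then have "T = fibre m j"
        using P m(3) TP by (auto simp: partition_on_def disjoint_def)
      then show False using fibre_subset_fibreD[OF m(1,2) m'(1,2)] m'(3) \<open>m' \<noteq> m\<close> by auto
    qed
    then show ?thesis using m' by blast
  qed
  moreover have "fibre m k \<in> P" if k: "k < m" for k
  proof -
    obtain x where x: "x \<in> X" "x m = k" using ex_in_fibre[OF m(1) k] by blast
    then obtain T where T: "T \<in> P" "x \<in> T" using P by (auto simp: partition_on_def)
    then show ?thesis using in_dir[OF T(1)] x by (auto simp: fibre_def)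
  qed
  ultimately show ?thesis using m(1) by blast
qed

lemma inj_on_fibre:
  assumes "m \<in> L"
  shows "inj_on (fibre m) {..<m}"
  using fibre_subset_fibreD[OF assms _ assms] by (auto simp: inj_on_def)

lemma Union_fibres: "m \<in> L \<Longrightarrow> (\<Union>j<m. fibre m j) = X"
  using X_less by (auto simp: fibre_def)

end

section \<open>Lifting factorizations along a map\<close>

text \<open>As \<open>f\<close> may identify points, the lift is a choice of points rather than a
  preimage. It is a set because each point occurs once in \<open>mset_set T\<close>.\<close>

lemma image_mset_set_eq_plusD:
  assumes "finite T" "image_mset f (mset_set T) = P + Q"
  shows "\<exists>T'\<subseteq>T. P = image_mset f (mset_set T') \<and> Q = image_mset f (mset_set (T - T'))"
proof -
  from assms(2) obtain A A' where A: "mset_set T = A + A'" "P = image_mset f A" "Q = image_mset f A'"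
    by (metis image_mset_eq_plusD)
  define T' where "T' = set_mset A"
  have sub: "T' \<subseteq> T" using A(1) assms(1) unfolding T'_def
    by (metis finite_set_mset_mset_set mset_subset_eq_add_left set_mset_mono)
  have "count A x \<le> 1" for x
  proof -
    have "count A x \<le> count (mset_set T) x" using A(1) by simp
    also have "\<dots> \<le> 1" by (simp add: count_mset_set')
    finally show ?thesis .
  qed
  then have "A = mset_set T'"
    unfolding T'_def by (intro multiset_eqI) (metis One_nat_def count_greater_zero_iff count_mset_set(1) count_mset_set(3) finite_set_mset le_antisym less_Suc_eq_le not_gr_zero not_less_eq)
  moreover have "A' = mset_set (T - T')"
    using A(1) sub assms(1) calculation by (simp add: mset_set_Diff)
  ultimately show ?thesis using A sub by blast
qed

text \<open>The factors are lifted one by one. Since no factor is empty, the blocks are nonempty and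
  hence distinct, even where their images coincide.\<close>

lemma sum_mset_eq_image_mset_set_partition:
  assumes "finite T" "\<Sum>\<^sub># z = image_mset f (mset_set T)" "{#} \<notin># z"
  shows "\<exists>P. partition_on T P \<and> z = image_mset (\<lambda>T'. image_mset f (mset_set T')) (mset_set P)"
  using assms
proof (induction z arbitrary: T)
  case empty
  then show ?case
    by (intro exI[of _ "{}"]) (auto simp: partition_on_def mset_set_empty_iff)
next
  case (add u z)
  then have "image_mset f (mset_set T) = u + \<Sum>\<^sub># z" by simp
  from image_mset_set_eq_plusD[OF add.prems(1) this] obtain T' where T': "T' \<subseteq> T"
    "u = image_mset f (mset_set T')" "\<Sum>\<^sub># z = image_mset f (mset_set (T - T'))" by blast
  obtain P where P: "partition_on (T - T') P"
    "z = image_mset (\<lambda>T'. image_mset f (mset_set T')) (mset_set P)"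
    using add.IH[OF _ T'(3)] add.prems by auto
  have "finite P" using P(1) add.prems(1) finite_elements by blast
  have ne: "T' \<noteq> {}" using T'(2) add.prems(3) by auto
  then have "T' \<notin> P" using P(1) by (auto simp: partition_on_def)
  moreover have "partition_on T (insert T' P)"
    using partition_on_insert[of T' P T] P(1) T'(1) ne
    by (auto simp: partition_on_def disjoint_def)
  ultimately show ?case
    using P(2) T'(2) \<open>finite P\<close> by (intro exI[of _ "insert T' P"]) simp
qed

section \<open>Minimal primes of the monoid of product-one sequences\<close>

context group
begin

lemma foldr_mult_closed: "set gs \<subseteq> carrier G \<Longrightarrow> foldr (\<otimes>) gs \<one> \<in> carrier G"
  by (induction gs) auto

lemma involution_pair_in_B: "r \<in> carrier G \<Longrightarrow> r \<otimes> r = \<one> \<Longrightarrow> {#r, r#} \<in> carrier B"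
  using B_carrierI[of "[r, r]"] by simp

text \<open>If \<open>r w\<close> is an ordering of \<open>S\<close> with product one, then \<open>w\<close> has product \<open>r\<close> and hence \<open>w w\<close>
  has product one.\<close>

lemma involution_pair_divides_double:
  assumes r: "r \<otimes> r = \<one>" and S: "S \<in> carrier B" "r \<in># S"
  shows "{#r, r#} divides\<^bsub>B\<^esub> (S + S)"
proof -
  obtain gs where gs: "mset gs = S" "set gs \<subseteq> carrier G" "foldr (\<otimes>) gs \<one> = \<one>"
    using B_carrierE[OF S(1)] by blast
  then have "r \<in> set gs" using S(2) by auto
  then obtain xs ys where xy: "gs = xs @ r # ys" by (metis split_list)
  let ?p = "\<lambda>zs. foldr (\<otimes>) zs \<one>"
  have cl: "set xs \<subseteq> carrier G" "set ys \<subseteq> carrier G" "r \<in> carrier G"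
    "?p xs \<in> carrier G" "?p ys \<in> carrier G"
    using gs(2) foldr_mult_closed unfolding xy by auto
  have "?p xs \<otimes> (r \<otimes> ?p ys) = \<one>"
    using gs(3) cl foldr_mult_append[of xs "r # ys"] unfolding xy by simp
  then have "(r \<otimes> ?p ys) \<otimes> ?p xs = \<one>"
    using cl by (metis inv_comm m_closed)
  then have "r \<otimes> ?p (ys @ xs) = r \<otimes> r"
    using cl r foldr_mult_append[of ys xs] by (simp add: m_assoc del: foldr_append)
  then have p: "?p (ys @ xs) = r"
    using cl foldr_mult_closed[of "ys @ xs"] by simp
  have "?p ((ys @ xs) @ (ys @ xs)) = ?p (ys @ xs) \<otimes> ?p (ys @ xs)"
    using cl by (intro foldr_mult_append) auto
  then have "?p ((ys @ xs) @ (ys @ xs)) = \<one>"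
    by (simp only: p r)
  then have "mset ((ys @ xs) @ (ys @ xs)) \<in> carrier B"
    using cl by (intro B_carrierI) auto
  moreover have "S + S = {#r, r#} + mset ((ys @ xs) @ (ys @ xs))"
    using gs(1) xy by auto
  ultimately show ?thesis unfolding divides_B_iff by blast
qed

lemma prime_s_ideal_containing: "prime_s_ideal B {S \<in> carrier B. r \<in># S}"
proof -
  let ?Q = "{S \<in> carrier B. r \<in># S}"
  have "?Q <#>\<^bsub>B\<^esub> carrier B \<subseteq> ?Q" by (auto simp: set_mult_def)
  moreover have "?Q \<subseteq> ?Q <#>\<^bsub>B\<^esub> carrier B"
    using empty_in_B by (force simp: set_mult_def)
  ultimately have "?Q <#>\<^bsub>B\<^esub> carrier B = ?Q" by (rule subset_antisym)
  moreover have "?Q \<noteq> carrier B"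
  proof
    assume "?Q = carrier B"
    then have "{#} \<in> ?Q" by (simp only: empty_in_B)
    then show False by simp
  qed
  ultimately show ?thesis
    by (auto simp: prime_s_ideal_def s_ideal_def)
qed

lemma minimal_prime_omits_involution:
  assumes r: "r \<in> carrier G" "r \<otimes> r = \<one>" and s: "s \<noteq> r" and P: "P \<in> minimal_primes B"
  shows "{#r, r#} \<notin> P \<or> {#s, s#} \<notin> P"
proof (rule ccontr)
  assume "\<not> ?thesis"
  then have rP: "{#r, r#} \<in> P" and sP: "{#s, s#} \<in> P" by auto
  let ?Q = "{S \<in> carrier B. r \<in># S}"
  have prime: "prime_s_ideal B P"
    and min: "\<And>Q. prime_s_ideal B Q \<Longrightarrow> Q \<noteq> {} \<Longrightarrow> Q \<subseteq> P \<Longrightarrow> Q = P"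
    using P by (auto simp: minimal_primes_def)
  have PB: "P <#>\<^bsub>B\<^esub> carrier B = P"
    and Pprime: "\<And>S T. S \<in> carrier B \<Longrightarrow> T \<in> carrier B \<Longrightarrow> S + T \<in> P \<Longrightarrow> S \<in> P \<or> T \<in> P"
    using prime by (auto simp: prime_s_ideal_def s_ideal_def)
  have "?Q \<subseteq> P"
  proof
    fix S assume S: "S \<in> ?Q"
    then obtain U where "U \<in> carrier B" "S + S = {#r, r#} + U"
      using involution_pair_divides_double[OF r(2)] unfolding divides_B_iff by blast
    then have "S + S \<in> P <#>\<^bsub>B\<^esub> carrier B"
      using rP unfolding set_mult_def B_mult by blast
    then show "S \<in> P" using Pprime[of S S] S PB by auto
  qed
  moreover have "{#r, r#} \<in> ?Q" using involution_pair_in_B r by simp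
  ultimately have "?Q = P" using min[OF prime_s_ideal_containing] by blast
  then show False using sP s by auto
qed

lemma quot_group_pow:
  assumes "S \<in> carrier B" "T \<in> carrier B"
  shows "quot B S T [^]\<^bsub>quot_group B\<^esub> (m::nat) = quot B (repeat_mset m S) (repeat_mset m T)"
proof -
  interpret B: comm_monoid_cancel B by (rule B_comm_monoid_cancel)
  interpret Q: comm_group "quot_group B" by (rule B.quot_group_is_comm_group)
  have cl: "repeat_mset m S \<in> carrier B" if "S \<in> carrier B" for m S
    using that by (induction m) auto
  show ?thesis
  proof (induction m)
    case 0
    show ?case by (simp add: quot_group_def)
  next
    case (Suc m)
    then show ?case
      using assms cl[OF assms(1), of m] cl[OF assms(2), of m]
      by (simp add: B.quot_group_mult add.commute)
  qed
qed

end

lemma mset_eq_three_iff: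
  "mset gs = {#p, q, r#} \<longleftrightarrow>
    gs \<in> {[p, q, r], [p, r, q], [q, p, r], [q, r, p], [r, p, q], [r, q, p]}"
proof
  assume "mset gs = {#p, q, r#}"
  moreover from this have "length gs = 3" by (metis size_mset size_add_mset size_empty numeral_3_eq_3)
  then obtain x y z where "gs = [x, y, z]" by (auto simp: numeral_3_eq_3 length_Suc_conv)
  ultimately show "gs \<in> {[p, q, r], [p, r, q], [q, p, r], [q, r, p], [r, p, q], [r, q, p]}"
    by (auto simp: add_eq_conv_ex)
qed (auto simp: add_mset_commute)

section \<open>The infinite dihedral group\<close>

text \<open>The interface to the presentation: an involution that inverts an element of infinite
  order.\<close>

locale infinite_dihedral = group +
  fixes a t
  assumes a_closed [simp]: "a \<in> carrier G" and t_closed [simp]: "t \<in> carrier G"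
    and tt [simp]: "t \<otimes> t = \<one>" and at: "a \<otimes> t = t \<otimes> inv a"
    and inf: "\<And>n::int. a [^] n = \<one> \<Longrightarrow> n = 0"
begin

lemma at': "x \<in> carrier G \<Longrightarrow> a \<otimes> (t \<otimes> x) = t \<otimes> (inv a \<otimes> x)"
  using at by (simp flip: m_assoc)

lemma tt' [simp]: "x \<in> carrier G \<Longrightarrow> t \<otimes> (t \<otimes> x) = x"
  by (simp flip: m_assoc)

lemma inv_at: "inv a \<otimes> t = t \<otimes> a"
proof -
  have "a \<otimes> (t \<otimes> a) = t" using at'[of a] by simp
  then have "inv a \<otimes> t = inv a \<otimes> (a \<otimes> (t \<otimes> a))" by simp
  then show ?thesis by (simp flip: m_assoc)
qed

lemma inv_at': "x \<in> carrier G \<Longrightarrow> inv a \<otimes> (t \<otimes> x) = t \<otimes> (a \<otimes> x)"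
  using inv_at by (simp flip: m_assoc)

lemma a_inv_a: "x \<in> carrier G \<Longrightarrow> a \<otimes> (inv a \<otimes> x) = x"
  and inv_a_a: "x \<in> carrier G \<Longrightarrow> inv a \<otimes> (a \<otimes> x) = x"
  by (simp_all flip: m_assoc)

text \<open>Moves \<open>t\<close> to the left past \<open>a\<close> and cancels, bringing words
  into the form of a power of \<open>t\<close> times a power of \<open>a\<close>.\<close>

lemmas normalize = m_assoc at at' inv_at inv_at' a_inv_a inv_a_a

lemma a_pow_neq_one: "n > 0 \<Longrightarrow> a [^] (n::nat) \<noteq> \<one>"
  using inf[of "int n"] by (auto simp: int_pow_int)

lemma a2_neq_one: "a \<otimes> a \<noteq> \<one>"
  using a_pow_neq_one[of 2] by (simp add: numeral_2_eq_2)

lemma a4_neq_one: "a \<otimes> (a \<otimes> (a \<otimes> a)) \<noteq> \<one>"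
  using a_pow_neq_one[of 4] by (simp add: eval_nat_numeral m_assoc)

lemma inv_a2_neq_one: "inv a \<otimes> inv a \<noteq> \<one>"
  using a2_neq_one by (metis a_closed inv_eq_1_iff inv_mult_group m_closed)

lemma inv_a4_neq_one: "inv a \<otimes> (inv a \<otimes> (inv a \<otimes> inv a)) \<noteq> \<one>"
proof
  assume "inv a \<otimes> (inv a \<otimes> (inv a \<otimes> inv a)) = \<one>"
  then have "inv (a \<otimes> (a \<otimes> (a \<otimes> a))) = \<one>" by (simp add: inv_mult_group m_assoc)
  then show False using a4_neq_one by (simp add: inv_eq_1_iff)
qed

text \<open>The only values that products of orderings of \<open>S = \<tau> \<cdot> \<tau>\<alpha> \<cdot> \<alpha>\<^sup>3\<close> can take are
  \<open>\<alpha>\<close> to the powers \<open>\<plusminus>2\<close> and \<open>\<plusminus>4\<close>.\<close>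

lemma not_seminormal_B: "\<not> seminormal B"
proof
  interpret B: comm_monoid_cancel B by (rule B_comm_monoid_cancel)
  assume sn: "seminormal B"
  define r where "r = t \<otimes> a"
  define c where "c = a \<otimes> (a \<otimes> a)"
  define S where "S = {#t, r, c#}"
  have notin: "S \<notin> carrier B"
  proof
    assume "S \<in> carrier B"
    then obtain gs where gs: "mset gs = S" "foldr (\<otimes>) gs \<one> = \<one>" using B_carrierE by blast
    from gs(1) have "gs \<in> {[t, r, c], [t, c, r], [r, t, c], [r, c, t], [c, t, r], [c, r, t]}"
      unfolding S_def mset_eq_three_iff .
    then show False
      using gs(2) a2_neq_one a4_neq_one inv_a2_neq_one inv_a4_neq_one
      by (auto simp: r_def c_def normalize)
  qed
  \<comment> \<open>Both \<open>c t\<close> and \<open>r\<close> are involutions.\<close>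
  have "S + S = mset [c, t, c, t, r, r]" by (simp add: S_def)
  also have "\<dots> \<in> carrier B"
    by (rule B_carrierI) (auto simp: r_def c_def normalize)
  finally have S2: "S + S \<in> carrier B" .
  \<comment> \<open>Here \<open>t c r\<close> is the power of \<open>a\<close> with exponent -2 and
    \<open>t r c\<close> the one with exponent 4.\<close>
  have "S + S + S = mset [t, c, r, t, c, r, t, r, c]" by (simp add: S_def)
  also have "\<dots> \<in> carrier B"
    by (rule B_carrierI) (auto simp: r_def c_def normalize)
  finally have S3: "S + S + S \<in> carrier B" .
  have Sm: "repeat_mset m S \<in> carrier B" if "m \<ge> 2" for m
    using that
  proof (induction m rule: less_induct)
    case (less m)
    consider "m = 2" | "m = 3" | "m - 2 \<ge> 2" "m - 2 < m" "m = (m - 2) + 2" using less.prems by linarith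
    then show ?case
    proof cases
      case 3
      then have "repeat_mset (m - 2) S + (S + S) \<in> carrier B" using less.IH S2 by blast
      moreover have "repeat_mset m S = repeat_mset (m - 2) S + (S + S)"
        by (subst 3(3)) (simp add: repeat_mset_distrib numeral_2_eq_2)
      ultimately show ?thesis by simp
    qed (use S2 S3 in \<open>simp_all add: numeral_2_eq_2 numeral_3_eq_3 add.assoc\<close>)
  qed
  \<comment> \<open>As \<open>S\<close> is not in \<open>B\<close>, it enters the quotient group as
    the fraction of its cube by its square.\<close>
  let ?x = "quot B (S + S + S) (S + S)"
  have "?x [^]\<^bsub>quot_group B\<^esub> m \<in> quot_embed B ` carrier B" if "m \<ge> 2" for m :: nat
  proof -
    have cl: "repeat_mset m (S + S + S) \<in> carrier B" "repeat_mset m (S + S) \<in> carrier B"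
      using that Sm[of m] by (auto simp: repeat_mset_distrib2)
    have "?x [^]\<^bsub>quot_group B\<^esub> m = quot_embed B (repeat_mset m S)"
      unfolding quot_group_pow[OF S3 S2] quot_embed_def
      using cl Sm[OF that] by (subst B.quot_eq_iff) (auto simp: repeat_mset_distrib2)
    then show ?thesis using Sm[OF that] by blast
  qed
  moreover have "?x \<in> carrier (quot_group B)" using S2 S3 B.quot_group_carrier by blast
  ultimately have "?x \<in> quot_embed B ` carrier B" using sn unfolding seminormal_def by blast
  then obtain T where T: "T \<in> carrier B" "?x = quot B T {#}" by (auto simp: quot_embed_def)
  then have "S + S + S = T + (S + S)" using S2 S3 by (simp add: B.quot_eq_iff)
  then have "T = S" by (metis add.commute add_right_cancel)
  then show False using T(1) notin by simp
qed

lemma not_weakly_Krull_B: "\<not> weakly_Krull B"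
proof
  interpret B: comm_monoid_cancel B by (rule B_comm_monoid_cancel)
  assume wK: "weakly_Krull B"
  let ?x = "quot B {#a, a, t, t#} {#t, t#}"
  have inB: "{#r, r#} \<in> carrier B" "{#a, a, r, r#} \<in> carrier B" if "r \<in> {t, t \<otimes> a}" for r
  proof -
    show "{#r, r#} \<in> carrier B"
      using that by (intro involution_pair_in_B) (auto simp: normalize)
    \<comment> \<open>The involution \<open>r\<close> inverts \<open>a\<close>.\<close>
    have "mset [a, r, a, r] \<in> carrier B"
      using that by (intro B_carrierI) (auto simp: normalize)
    then show "{#a, a, r, r#} \<in> carrier B" by (simp add: add_mset_commute)
  qed
  have "?x \<in> localization B P" if P: "P \<in> minimal_primes B" for P
  proof -
    \<comment> \<open>For one of the two involutions \<open>t\<close> and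
      \<open>t \<otimes> a\<close> the pair lies outside \<open>P\<close> and may serve as
      denominator.\<close>
    have "t \<otimes> a \<noteq> t" using a2_neq_one by auto
    then obtain r where r: "r \<in> {t, t \<otimes> a}" "{#r, r#} \<notin> P"
      using minimal_prime_omits_involution[OF t_closed tt _ P] by blast
    have "?x = quot B {#a, a, r, r#} {#r, r#}"
      using inB[OF r(1)] inB[of t] by (simp add: B.quot_eq_iff add_mset_commute)
    then show ?thesis using r inB unfolding localization_def by blast
  qed
  moreover have "?x \<in> carrier (quot_group B)" using inB[of t] B.quot_group_carrier by blast
  ultimately have "?x \<in> quot_embed B ` carrier B" using wK unfolding weakly_Krull_def by blast
  then obtain T where T: "T \<in> carrier B" "?x = quot B T {#}" by (auto simp: quot_embed_def)
  then have "{#a, a, t, t#} = T + {#t, t#}" using inB[of t] by (simp add: B.quot_eq_iff)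
  then have "{#a, a#} + {#t, t#} = T + {#t, t#}" by simp
  then have "T = {#a, a#}" unfolding add_right_cancel by simp
  then obtain gs where gs: "mset gs = {#a, a#}" "foldr (\<otimes>) gs \<one> = \<one>" using B_carrierE T(1) by metis
  have "length gs = size (mset gs)" "set gs = set_mset (mset gs)" by simp_all
  then have "length gs = 2" "set gs = {a}" unfolding gs(1) by simp_all
  then have "gs = [a, a]" using replicate_eqI[of gs 2 a] by (simp add: numeral_2_eq_2)
  then show False using gs(2) a2_neq_one by simp
qed

end

lemma zero_sum_constant_mset:
  fixes x :: int
  assumes "x \<noteq> 0" "set_mset M \<subseteq> {x}" "\<Sum>\<^sub># M = 0"
  shows "M = {#}"
proof -
  have M: "M = replicate_mset (size M) x"
    using assms(2) by (metis set_mset_subset_singletonD size_replicate_mset)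
  then have "int (size M) * x = 0"
    using assms(3) by (metis sum_mset_replicate_mset of_nat_id)
  then show ?thesis using assms(1) by simp
qed

section \<open>Sequences of rotations\<close>

context infinite_dihedral
begin

definition rot :: "int multiset \<Rightarrow> 'a multiset" where
  "rot M = image_mset (\<lambda>k. a [^] k) M"

lemma rot_simps [simp]: "rot {#} = {#}" "rot (M + N) = rot M + rot N" "size (rot M) = size M"
  "rot M = {#} \<longleftrightarrow> M = {#}"
  by (simp_all add: rot_def)

lemma inj_pow: "inj (\<lambda>k::int. a [^] k)"
proof (rule injI)
  fix m n :: int assume "a [^] m = a [^] n"
  then have "a [^] (m - n) = \<one>" by (simp add: int_pow_diff)
  then show "m = n" using inf by fastforce
qed

text \<open>Powers of \<open>a\<close> commute, so every ordering has the product
  \<open>a [^] \<Sum>\<^sub># M\<close>, which is trivial only for exponent 0.\<close>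

lemma rot_in_B_iff: "rot M \<in> carrier B \<longleftrightarrow> \<Sum>\<^sub># M = 0"
proof -
  have prod: "foldr (\<otimes>) (map (\<lambda>k. a [^] k) ks) \<one> = a [^] sum_list ks" for ks :: "int list"
    by (induction ks) (auto simp: int_pow_mult)
  show ?thesis
  proof
    assume "rot M \<in> carrier B"
    then obtain gs where gs: "mset gs = rot M" "foldr (\<otimes>) gs \<one> = \<one>" using B_carrierE by blast
    have "set gs = set_mset (rot M)" using gs(1) by (metis set_mset_mset)
    then have "\<forall>g\<in>set gs. \<exists>k::int. g = a [^] k" by (auto simp: rot_def)
    then obtain ks :: "int list" where ks: "gs = map (\<lambda>k. a [^] k) ks"
      using ex_map_conv[of gs "\<lambda>k::int. a [^] k"] by blast
    have "image_mset (\<lambda>k. a [^] k) (mset ks) = image_mset (\<lambda>k. a [^] k) M"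
      using gs(1) ks by (simp add: rot_def)
    then have "mset ks = M" using multiset.inj_map[OF inj_pow] by (simp add: inj_eq)
    moreover have "sum_list ks = 0" using gs(2) ks prod inf by simp
    ultimately show "\<Sum>\<^sub># M = 0" by (metis sum_mset_sum_list)
  next
    assume "\<Sum>\<^sub># M = 0"
    moreover obtain ks where ks: "mset ks = M" by (metis ex_mset)
    ultimately have "sum_list ks = 0" by (simp flip: sum_mset_sum_list)
    then have "mset (map (\<lambda>k. a [^] k) ks) \<in> carrier B"
      using prod by (intro B_carrierI) auto
    then show "rot M \<in> carrier B" using ks by (simp add: rot_def)
  qed
qed

lemma rot_eq_plusD:
  assumes "rot M = S + T"
  obtains M\<^sub>1 M\<^sub>2 where "M = M\<^sub>1 + M\<^sub>2" "S = rot M\<^sub>1" "T = rot M\<^sub>2"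
  using assms unfolding rot_def by (metis image_mset_eq_plusD)

text \<open>Divisors of a sequence of rotations consist of rotations, so irreducibility can be
  tested on zero-sum sequences over the integers.\<close>

lemma rot_atom_iff:
  "rot M \<in> atoms B \<longleftrightarrow> M \<noteq> {#} \<and> \<Sum>\<^sub># M = 0 \<and>
     (\<forall>M\<^sub>1 M\<^sub>2. M = M\<^sub>1 + M\<^sub>2 \<longrightarrow> \<Sum>\<^sub># M\<^sub>1 = 0 \<longrightarrow> \<Sum>\<^sub># M\<^sub>2 = 0 \<longrightarrow> M\<^sub>1 = {#} \<or> M\<^sub>2 = {#})"
  (is "_ \<longleftrightarrow> ?R")
proof
  assume at: "rot M \<in> atoms B"
  have "M\<^sub>1 = {#} \<or> M\<^sub>2 = {#}" if "M = M\<^sub>1 + M\<^sub>2" "\<Sum>\<^sub># M\<^sub>1 = 0" "\<Sum>\<^sub># M\<^sub>2 = 0" for M\<^sub>1 M\<^sub>2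
  proof -
    have "rot M = rot M\<^sub>1 + rot M\<^sub>2" "rot M\<^sub>1 \<in> carrier B" "rot M\<^sub>2 \<in> carrier B"
      using that by (simp_all add: rot_in_B_iff)
    then have "rot M\<^sub>1 = {#} \<or> rot M\<^sub>2 = {#}" using at unfolding atoms_B_iff by blast
    then show ?thesis by simp
  qed
  then show ?R using at by (auto simp: atoms_B_iff rot_in_B_iff)
next
  assume M: ?R
  have "S = {#} \<or> T = {#}" if "S \<in> carrier B" "T \<in> carrier B" "rot M = S + T" for S T
  proof -
    from rot_eq_plusD[OF that(3)] obtain M\<^sub>1 M\<^sub>2
      where "M = M\<^sub>1 + M\<^sub>2" "S = rot M\<^sub>1" "T = rot M\<^sub>2" .
    then show ?thesis using M that by (simp add: rot_in_B_iff)
  qed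
  then show "rot M \<in> atoms B" using M by (simp add: atoms_B_iff rot_in_B_iff)
qed

section \<open>Failure of local tameness\<close>

text \<open>The part without the peak \<open>e * int n\<close> consists of copies of
  \<open>- e\<close>, so it has sum zero only if it is empty.\<close>

lemma atom_peak:
  assumes n: "n > 0" and e: "e \<in> {1, -1 :: int}"
  shows "rot (add_mset (e * int n) (replicate_mset n (- e))) \<in> atoms B" (is "rot ?M \<in> _")
proof -
  have "M\<^sub>1 = {#} \<or> M\<^sub>2 = {#}" if M: "?M = M\<^sub>1 + M\<^sub>2" "\<Sum>\<^sub># M\<^sub>1 = 0" "\<Sum>\<^sub># M\<^sub>2 = 0" for M\<^sub>1 M\<^sub>2
  proof -
    have *: "N' = {#}" if N: "?M = N + N'" "\<Sum>\<^sub># N' = 0" "e * int n \<in># N" for N N'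
    proof -
      obtain N0 where "N = add_mset (e * int n) N0" using N(3) by (metis multi_member_split)
      then have "replicate_mset n (- e) = N0 + N'" using N(1) by simp
      then have "set_mset N' \<subseteq> set_mset (replicate_mset n (- e))" by simp
      also have "\<dots> \<subseteq> {- e}" by (simp add: set_mset_replicate_mset_subset)
      finally show "N' = {#}"
        using N(2) e by (intro zero_sum_constant_mset[of "- e"]) auto
    qed
    have "e * int n \<in># M\<^sub>1 + M\<^sub>2" unfolding M(1)[symmetric] by simp
    then show ?thesis
      using *[of M\<^sub>1 M\<^sub>2] *[of M\<^sub>2 M\<^sub>1] M by (auto simp: add.commute)
  qed
  then show ?thesis using n by (auto simp: rot_atom_iff)
qed

lemma atom_pair:
  fixes k :: int
  assumes "k \<noteq> 0"
  shows "rot {#k, - k#} \<in> atoms B"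
proof -
  have "M\<^sub>1 = {#} \<or> M\<^sub>2 = {#}" if M: "{#k, - k#} = M\<^sub>1 + M\<^sub>2" "\<Sum>\<^sub># M\<^sub>1 = 0" "\<Sum>\<^sub># M\<^sub>2 = 0" for M\<^sub>1 M\<^sub>2
  proof -
    have "size M\<^sub>1 + size M\<^sub>2 = 2" using M(1) by (metis size_union size_add_mset size_empty numeral_2_eq_2)
    then consider "size M\<^sub>1 = 0" | "size M\<^sub>2 = 0" | "size M\<^sub>1 = 1" by linarith
    then show ?thesis
    proof cases
      case 3
      then obtain x where x: "M\<^sub>1 = {#x#}" by (metis size_1_singleton_mset)
      then have "x \<in># {#k, - k#}" unfolding M(1) by simp
      then show ?thesis using x M(2) assms by auto
    qed simp_all
  qed
  then show ?thesis by (auto simp: rot_atom_iff)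
qed

text \<open>An atom containing \<open>k\<close> and \<open>- k\<close> is just that pair. Every atom
  below \<open>?W\<close> contains such a pair: fewer than \<open>n\<close> units of either sign
  cannot balance a single \<open>n\<close> or \<open>- n\<close>, so opposite entries occur equally
  often.\<close>

lemma atom_below_pairs:
  assumes n: "n > 0" and at: "rot M \<in> atoms B"
    and sub: "M \<subseteq># {#int n, - int n#} + replicate_mset (n - 1) 1 + replicate_mset (n - 1) (- 1)"
      (is "_ \<subseteq># ?W")
  shows "size M \<le> 2"
proof (cases "n = 1")
  \<comment> \<open>For \<open>n = 1\<close> the entries \<open>n\<close> and \<open>- n\<close>
    would coincide with the units, which breaks the count below.\<close>
  case True
  then show ?thesis using size_mset_mono[OF sub] by simp
next
  case False
  then have n2: "n \<ge> 2" using n by simp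
  have zs: "\<Sum>\<^sub># M = 0" and M0: "M \<noteq> {#}"
    and irr: "\<And>M\<^sub>1 M\<^sub>2. M = M\<^sub>1 + M\<^sub>2 \<Longrightarrow> \<Sum>\<^sub># M\<^sub>1 = 0 \<Longrightarrow> \<Sum>\<^sub># M\<^sub>2 = 0 \<Longrightarrow> M\<^sub>1 = {#} \<or> M\<^sub>2 = {#}"
    using at[unfolded rot_atom_iff] by (blast, blast, simp)
  have pair: "size M \<le> 2" if k: "{#k, - k#} \<subseteq># M" for k
  proof -
    obtain M' where M': "M = {#k, - k#} + M'" using k unfolding subset_mset.le_iff_add by blast
    then have "M' = {#}" using irr[OF M'] zs by simp
    then show ?thesis using M' by simp
  qed
  define p q r s where pqrs: "p = count M (int n)" "q = count M (- int n)" "r = count M 1" "s = count M (- 1)"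
  have cnt: "count M x \<le> count ?W x" for x using sub by (simp add: subseteq_mset_def)
  have "p \<le> 1" "q \<le> 1" "r \<le> n - 1" "s \<le> n - 1"
    using cnt[of "int n"] cnt[of "- int n"] cnt[of 1] cnt[of "- 1"] n2 unfolding pqrs by auto
  have M: "M = replicate_mset p (int n) + replicate_mset q (- int n) + replicate_mset r 1 + replicate_mset s (- 1)"
  proof (rule multiset_eqI)
    fix x
    show "count M x = count (replicate_mset p (int n) + replicate_mset q (- int n)
      + replicate_mset r 1 + replicate_mset s (- 1)) x"
      using cnt[of x] n2 by (auto simp: pqrs split: if_splits)
  qed
  have "int p * int n - int q * int n + int r - int s = 0"
    using zs by (subst (asm) M) simp
  then have eq: "(int p - int q) * int n = int s - int r" by (simp add: algebra_simps)
  have "p = q"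
  proof (rule ccontr)
    assume "p \<noteq> q"
    then have "int p - int q = 1 \<or> int p - int q = - 1" using \<open>p \<le> 1\<close> \<open>q \<le> 1\<close> by linarith
    then show False using eq \<open>r \<le> n - 1\<close> \<open>s \<le> n - 1\<close> n2 by auto
  qed
  then have "r = s" using eq by simp
  show ?thesis
  proof (cases "p = 0")
    case True
    then have "r > 0" using M M0 \<open>p = q\<close> \<open>r = s\<close> by auto
    then have "{#1, - 1#} \<subseteq># M"
      using \<open>r = s\<close> unfolding pqrs by (auto simp: subseteq_mset_def)
    then show ?thesis by (rule pair)
  next
    case False
    then have "count M (int n) > 0" "count M (- int n) > 0" using \<open>p = q\<close> unfolding pqrs by simp_all
    then have "{#int n, - int n#} \<subseteq># M"
      using n2 by (auto simp: subseteq_mset_def)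
    then show ?thesis by (rule pair)
  qed
qed

text \<open>The product of the atoms \<open>n (-1)\<^sup>n\<close> and \<open>(-n) 1\<^sup>n\<close> of \<open>\<B>(\<int>)\<close> is divisible by the atom
  \<open>1 (-1)\<close>, but then all other factors are pairs, too.\<close>

lemma not_locally_tame_B: "\<not> locally_tame B"
proof
  assume tame: "locally_tame B"
  let ?u = "rot {#1, - 1#}"
  have u: "?u \<in> atoms B" using atom_pair[of 1] by simp
  let ?P = "\<lambda>N::enat. \<forall>b\<in>carrier B. (\<exists>y\<in>factorizations B b. ?u \<in># y) \<longrightarrow>
       (\<forall>z\<in>factorizations B b. \<exists>z'\<in>factorizations B b. ?u \<in># z' \<and> enat (fact_dist z z') \<le> N)"
  have "?P \<infinity>" by auto
  then have least: "?P (tame_degree B ?u)" unfolding tame_degree_def by (rule LeastI)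
  obtain N where N: "tame_degree B ?u = enat N"
    using tame u unfolding locally_tame_def by (metis less_infinityE)
  \<comment> \<open>A factorization using \<open>?u\<close> will have at least \<open>n + 1\<close>
    factors, hence distance at least \<open>n - 1\<close> > \<open>N\<close> from the one with two
    factors.\<close>
  define n where "n = N + 3"
  let ?R = "{#int n, - int n#} + replicate_mset (n - 1) 1 + replicate_mset (n - 1) (- 1)"
  let ?U = "add_mset (int n) (replicate_mset n (- 1))"
  let ?V = "add_mset (- int n) (replicate_mset n 1)"
  have n: "n = Suc (n - 1)" by (simp add: n_def)
  have UV: "?U + ?V = {#1, - 1#} + ?R" by (subst (2 4) n) simp
  have inB: "rot (?U + ?V) \<in> carrier B" "rot ?R \<in> carrier B" by (simp_all add: rot_in_B_iff del: rot_simps)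
  \<comment> \<open>This ensures that \<open>?u\<close> occurs in some factorization, as the tame
    degree requires.\<close>
  obtain y where "y \<in> factorizations B (rot ?R)" using factorizations_B_nonempty[OF inB(2)] by blast
  then have "add_mset ?u y \<in> factorizations B (rot (?U + ?V))"
    using u unfolding UV rot_simps(2)[of "{#1, - 1#}" ?R] by (simp add: factorizations_B_iff del: rot_simps(2))
  moreover have "rot ?U \<in> atoms B" "rot ?V \<in> atoms B"
    using atom_peak[of n 1] atom_peak[of n "- 1"] by (simp_all add: n_def)
  then have z: "{#rot ?U, rot ?V#} \<in> factorizations B (rot (?U + ?V))"
    unfolding rot_simps(2)[of ?U ?V] by (simp add: factorizations_B_iff del: rot_simps(2))
  ultimately obtain z' where z': "z' \<in> factorizations B (rot (?U + ?V))" "?u \<in># z'"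
    "fact_dist {#rot ?U, rot ?V#} z' \<le> N"
    using least inB(1) unfolding N enat_ord_simps by (metis union_single_eq_member add_mset_add_single)
  obtain z'' where z'': "z' = add_mset ?u z''" using z'(2) by (metis multi_member_split)
  have "rot (?U + ?V) = ?u + rot ?R" unfolding UV by (rule rot_simps(2))
  then have at: "set_mset z'' \<subseteq> atoms B" and sum: "\<Sum>\<^sub># z'' = rot ?R"
    using z'(1) unfolding z'' by (auto simp: factorizations_B_iff)
  have "size v \<le> 2" if v: "v \<in># z''" for v
  proof -
    obtain w where "z'' = add_mset v w" using v by (metis multi_member_split)
    then have "rot ?R = v + \<Sum>\<^sub># w" using sum by simp
    then obtain M M' where M: "?R = M + M'" "v = rot M" by (elim rot_eq_plusD)
    have "M \<subseteq># ?R" unfolding M(1) by simp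
    then have "size M \<le> 2"
      using atom_below_pairs[of n M] at v M(2) by (auto simp: n_def)
    then show ?thesis using M(2) by simp
  qed
  moreover have "(\<forall>v\<in>#w. size v \<le> 2) \<Longrightarrow> size (\<Sum>\<^sub># w) \<le> 2 * size w" for w :: "'a multiset multiset"
    by (induction w) auto
  ultimately have "size (\<Sum>\<^sub># z'') \<le> 2 * size z''" by blast
  then have "2 * n \<le> 2 * size z''" unfolding sum using n by simp
  then have "n + 1 \<le> size z'" unfolding z'' by simp
  moreover have "size ({#rot ?U, rot ?V#} \<inter># z') \<le> size {#rot ?U, rot ?V#}"
    by (intro size_mset_mono) simp
  ultimately show False using z'(3) by (simp add: fact_dist_def n_def)
qed

section \<open>Sets of lengths\<close>

lemma ex_length_set_eq:
  assumes L: "finite L" "L \<noteq> {}" "L \<subseteq> {2..}"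
  shows "\<exists>S\<in>carrier B. length_set B S = L"
proof -
  interpret grid L by unfold_locales (use L in auto)
  obtain g :: "(nat \<Rightarrow> nat) \<Rightarrow> int"
    where g: "\<And>T. T \<subseteq> X \<Longrightarrow> sum g T = 0 \<longleftrightarrow> (\<exists>m\<in>L. cylinder m T)"
    using ex_grid_weights by metis
  \<comment> \<open>The point \<open>x\<close> contributes one rotation, so zero-sum subsets of
    \<open>X\<close> index the divisors of \<open>seq X\<close>.\<close>
  define f where "f = (\<lambda>x. a [^] g x)"
  define seq where "seq T = image_mset f (mset_set T)" for T
  have finT: "finite T" if "T \<subseteq> X" for T using that finite_X finite_subset by blast
  have seq_in_B: "seq T \<in> carrier B \<longleftrightarrow> (\<exists>m\<in>L. cylinder m T)" if "T \<subseteq> X" for T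
  proof -
    have "seq T = rot (image_mset g (mset_set T))"
      by (simp add: seq_def rot_def f_def image_mset.compositionality comp_def)
    then show ?thesis using g[OF that] by (simp add: rot_in_B_iff sum_unfold_sum_mset)
  qed
  have seq_empty: "seq T = {#} \<longleftrightarrow> T = {}" if "T \<subseteq> X" for T
    using finT[OF that] by (auto simp: seq_def mset_set_empty_iff)
  have fibre_in_B: "seq (fibre m j) \<in> carrier B" if "m \<in> L" for m j
    using that seq_in_B[OF fibre_subset_X] cylinder_fibre by blast
  have contains_fibre: "\<exists>m\<in>L. \<exists>j<m. fibre m j \<subseteq> T"
    if "T \<subseteq> X" "T \<noteq> {}" "seq T \<in> carrier B" for T
    using that seq_in_B fibre_subset_cylinder by meson
  have seq_diff: "seq T = seq T' + seq (T - T')" if "T' \<subseteq> T" "T \<subseteq> X" for T T'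
  proof -
    have "mset_set T = mset_set T' + mset_set (T - T')"
      using that finT by (metis Diff_disjoint Un_Diff_cancel Un_absorb1 finite_Diff finite_subset mset_set_Union)
    then show ?thesis by (simp add: seq_def)
  qed
  have fibre_atom: "seq (fibre m j) \<in> atoms B" if mj: "m \<in> L" "j < m" for m j
  proof -
    have "P = {#} \<or> Q = {#}"
      if PQ: "P \<in> carrier B" "Q \<in> carrier B" "seq (fibre m j) = P + Q" for P Q
    proof (rule ccontr)
      assume ne: "\<not> (P = {#} \<or> Q = {#})"
      obtain T where T: "T \<subseteq> fibre m j" "P = seq T" "Q = seq (fibre m j - T)"
        using image_mset_set_eq_plusD[OF finT[OF fibre_subset_X] PQ(3)[unfolded seq_def]]
        unfolding seq_def by blast
      have "T \<subseteq> X" "T \<noteq> {}" using T fibre_subset_X ne by (auto simp: seq_def)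
      \<comment> \<open>A nonempty part with product one contains a fibre, and nested fibres are
        equal.\<close>
      then obtain m' j' where m': "m' \<in> L" "j' < m'" "fibre m' j' \<subseteq> T"
        using contains_fibre PQ(1) T(2) by blast
      then have "m' = m \<and> j' = j" using fibre_subset_fibreD[OF mj m'(1,2)] T(1) by blast
      then have "Q = {#}" using m'(3) T(1,3) by (auto simp: seq_def)
      then show False using ne by blast
    qed
    then show ?thesis
      using fibre_in_B[OF mj(1)] fibre_nonempty[OF mj] seq_empty[OF fibre_subset_X]
      by (auto simp: atoms_B_iff)
  qed
  have atom_fibre: "\<exists>m\<in>L. \<exists>j<m. T = fibre m j" if T: "T \<subseteq> X" "seq T \<in> atoms B" for T
  proof -
    have "T \<noteq> {}" using T(2) by (auto simp: seq_def atoms_B_iff)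
    then obtain m j where mj: "m \<in> L" "j < m" "fibre m j \<subseteq> T"
      using contains_fibre[OF T(1)] atom_in_B[OF T(2)] by blast
    have cyl: "\<exists>k\<in>L. cylinder k T" using T atom_in_B seq_in_B by blast
    \<comment> \<open>The complement of the fibre in \<open>T\<close> also has sum zero, so
      irreducibility of \<open>seq T\<close> makes it empty.\<close>
    have "sum g T = sum g (T - fibre m j) + sum g (fibre m j)"
      using sum.subset_diff[OF mj(3)] finT T(1) by blast
    moreover have "sum g T = 0" "sum g (fibre m j) = 0"
      using cyl g[OF T(1)] g[OF fibre_subset_X] cylinder_fibre mj(1) by blast+
    ultimately have "sum g (T - fibre m j) = 0" by simp
    moreover have sub: "T - fibre m j \<subseteq> X" using T(1) by blast
    ultimately have "seq (T - fibre m j) \<in> carrier B" using g seq_in_B by blast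
    moreover have "seq T = seq (fibre m j) + seq (T - fibre m j)" using seq_diff mj(3) T(1) by blast
    ultimately have "seq (fibre m j) = {#} \<or> seq (T - fibre m j) = {#}"
      using T(2) fibre_in_B[OF mj(1)] unfolding atoms_B_iff by blast
    then have "T - fibre m j = {}"
      using fibre_nonempty[OF mj(1,2)] seq_empty[OF fibre_subset_X] seq_empty[OF sub] by blast
    then show ?thesis using mj by blast
  qed
  have "X \<noteq> {}" using L ex_in_fibre by (metis all_not_in_conv atLeast_iff subsetD zero_less_numeral less_le_trans)
  have "cylinder m X" if "m \<in> L" for m by (auto simp: cylinder_def)
  then have XB: "seq X \<in> carrier B" using seq_in_B[of X] L by blast
  have "length_set B (seq X) = L"
  proof (intro equalityI subsetI)
    fix l assume "l \<in> length_set B (seq X)"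
    then obtain z where z: "z \<in> factorizations B (seq X)" "size z = l" by (elim length_setE)
    then have zat: "set_mset z \<subseteq> atoms B" and zsum: "\<Sum>\<^sub># z = image_mset f (mset_set X)"
      by (auto simp: factorizations_B_iff seq_def)
    have "{#} \<notin># z" using zat atom_nonempty by blast
    from sum_mset_eq_image_mset_set_partition[OF finite_X zsum this]
    obtain P where P: "partition_on X P" "z = image_mset seq (mset_set P)"
      unfolding seq_def by blast
    have finP: "finite P" using P(1) finite_X finite_elements by blast
    have "\<exists>m\<in>L. \<exists>j<m. T = fibre m j" if "T \<in> P" for T
    proof (rule atom_fibre)
      show "T \<subseteq> X" using that P(1) by (auto simp: partition_on_def)
      show "seq T \<in> atoms B" using zat that finP unfolding P(2) by auto
    qed
    then obtain m where m: "m \<in> L" "P = fibre m ` {..<m}"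
      using partition_on_fibres[OF P(1)] by blast
    then have "card P = m" by (simp add: card_image inj_on_fibre)
    then show "l \<in> L" using m(1) z(2) P(2) by simp
  next
    fix m assume m: "m \<in> L"
    let ?z = "image_mset (\<lambda>j. seq (fibre m j)) (mset_set {..<m})"
    \<comment> \<open>The fibres are disjoint, so \<open>seq\<close> turns their union into a sum;
      \<open>k = m\<close> yields \<open>seq X\<close>.\<close>
    have "(\<Sum>j<k. seq (fibre m j)) = seq (\<Union>j<k. fibre m j)" for k
    proof (induction k)
      case (Suc k)
      let ?T = "\<Union>j<Suc k. fibre m j"
      have "?T - (\<Union>j<k. fibre m j) = fibre m k" by (auto simp: fibre_def less_Suc_eq)
      moreover have "?T \<subseteq> X" using fibre_subset_X by blast
      then have "seq ?T = seq (\<Union>j<k. fibre m j) + seq (?T - (\<Union>j<k. fibre m j))"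
        by (intro seq_diff) (auto simp: less_Suc_eq)
      ultimately show ?case using Suc by simp
    qed (simp add: seq_def)
    then have "\<Sum>\<^sub># ?z = seq X"
      using Union_fibres[OF m] by (simp flip: sum_unfold_sum_mset)
    then have "?z \<in> factorizations B (seq X)"
      using fibre_atom m by (auto simp: factorizations_B_iff)
    then show "m \<in> length_set B (seq X)" by (force simp: length_set_def)
  qed
  then show ?thesis using XB by blast
qed

section \<open>The system of sets of lengths, its distances and unions\<close>

lemma length_sets_B: "length_sets B = {L. L \<subseteq> {2..} \<and> finite L \<and> L \<noteq> {}} \<union> {{0}, {1}}"
proof (intro equalityI subsetI)
  fix L assume "L \<in> length_sets B"
  then show "L \<in> {L. L \<subseteq> {2..} \<and> finite L \<and> L \<noteq> {}} \<union> {{0}, {1}}"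
    using length_set_B_cases unfolding length_sets_def by blast
next
  fix L assume "L \<in> {L. L \<subseteq> {2..} \<and> finite L \<and> L \<noteq> {}} \<union> {{0::nat}, {1}}"
  then consider "finite L" "L \<noteq> {}" "L \<subseteq> {2..}" | "L = {0}" | "L = {1}" by blast
  then show "L \<in> length_sets B"
  proof cases
    case 1
    then show ?thesis using ex_length_set_eq unfolding length_sets_def by blast
  next
    case 2
    then show ?thesis using length_set_empty empty_in_B unfolding length_sets_def by blast
  next
    case 3
    have "{#\<one>#} \<in> carrier B" using B_carrierI[of "[\<one>]"] by simp
    then show ?thesis using 3 length_set_one unfolding length_sets_def by blast
  qed
qed

lemma delta_B: "delta B = {1..}"
proof (intro equalityI subsetI)
  fix d :: nat assume "d \<in> {1..}"
  then have "{2, 2 + d} \<in> length_sets B" "d \<in> delta_set {2, 2 + d}"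
    by (auto simp: length_sets_B delta_set_def)
  then show "d \<in> delta B" by (auto simp: delta_def)
qed (auto simp: delta_def delta_set_def)

lemma unions_of_lengths_B:
  assumes "k \<ge> 2"
  shows "unions_of_lengths B k = {2..}"
proof (intro equalityI subsetI)
  fix n assume "n \<in> unions_of_lengths B k"
  then show "n \<in> {2..}" using assms by (auto simp: unions_of_lengths_def length_sets_B)
next
  fix n :: nat assume "n \<in> {2..}"
  then have "{k, n} \<in> length_sets B" using assms by (simp add: length_sets_B)
  then show "n \<in> unions_of_lengths B k" by (auto simp: unions_of_lengths_def)
qed

end

section \<open>The presentation\<close>

text \<open>The presented group acts on \<open>\<int>\<close>, with \<open>\<alpha>\<close> and \<open>\<tau>\<close> acting as \<open>k \<mapsto> k + 1\<close> and \<open>k \<mapsto> -k\<close>.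
  In this action \<open>\<alpha>\<close> has infinite order.\<close>

fun letter_action :: "dihedral_gen \<times> bool \<Rightarrow> int \<Rightarrow> int" where
  "letter_action (Alpha, b) k = (if b then k + 1 else k - 1)"
| "letter_action (Tau, b) k = - k"

definition word_action :: "dihedral_gen gword \<Rightarrow> int \<Rightarrow> int" where
  "word_action w k = foldr letter_action w k"

abbreviation dihedral_relators :: "(dihedral_gen gword \<times> dihedral_gen gword) set" where
  "dihedral_relators \<equiv> {([(Tau, True), (Tau, True)], []),
      ([(Alpha, True), (Tau, True)], [(Tau, True), (Alpha, False)])}"

text \<open>The first relator holds as - (- k) = k, the second as (- k) + 1 = - (k - 1).\<close>

lemma word_action_cong: "word_cong dihedral_relators u v \<Longrightarrow> word_action u = word_action v"
proof (induction rule: word_cong.induct)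
  case (append u u' v v')
  have "word_action (x @ y) = word_action x \<circ> word_action y" for x y
    by (auto simp: word_action_def)
  then show ?case using append.IH by simp
next
  case (cancel x b)
  then show ?case by (cases x) (auto simp: word_action_def)
qed (auto simp: word_action_def)

lemma word_action_replicate: "word_action (replicate n (Alpha, True)) k = k + int n"
  by (induction n) (auto simp: word_action_def)

lemma infinite_dihedral_group_generators:
  "\<exists>a t. infinite_dihedral infinite_dihedral_group a t"
proof -
  let ?R = dihedral_relators
  let ?D = infinite_dihedral_group
  define cl where "cl w = {v. word_cong ?R w v}" for w
  have D: "?D = presented_group ?R" by (simp add: infinite_dihedral_group_def)
  interpret D: group ?D unfolding D by (rule presented_group_is_group)
  have mult: "cl u \<otimes>\<^bsub>?D\<^esub> cl v = cl (u @ v)" for u v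
    unfolding D cl_def by (rule presented_group_mult)
  have carr: "cl u \<in> carrier ?D" for u unfolding D cl_def presented_group_carrier by blast
  have one: "\<one>\<^bsub>?D\<^esub> = cl []" by (simp add: D cl_def presented_group_def)
  have cl_eq: "cl u = cl v \<longleftrightarrow> word_cong ?R u v" for u v
    unfolding cl_def by (auto intro: word_cong.refl word_cong.sym word_cong.trans)
  let ?a = "cl [(Alpha, True)]" and ?t = "cl [(Tau, True)]"
  have "cl [(Alpha, False)] \<otimes>\<^bsub>?D\<^esub> ?a = \<one>\<^bsub>?D\<^esub>"
    using word_cong.cancel[of ?R Alpha False] by (simp add: mult one cl_eq)
  then have inv: "inv\<^bsub>?D\<^esub> ?a = cl [(Alpha, False)]"
    using D.inv_equality carr by blast
  have pow: "?a [^]\<^bsub>?D\<^esub> (n::nat) = cl (replicate n (Alpha, True))" for n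
    by (induction n) (simp_all add: one mult replicate_append_same)
  have nat_inf: "n = 0" if "?a [^]\<^bsub>?D\<^esub> (n::nat) = \<one>\<^bsub>?D\<^esub>" for n
  proof -
    \<comment> \<open>A word representing the identity fixes 0, whereas this one maps 0 to
      \<open>n\<close>.\<close>
    have "word_cong ?R (replicate n (Alpha, True)) []" using that by (simp add: pow one cl_eq)
    then have "word_action (replicate n (Alpha, True)) 0 = word_action [] 0"
      by (simp add: word_action_cong)
    then show ?thesis by (simp add: word_action_replicate) (simp add: word_action_def)
  qed
  have "infinite_dihedral ?D ?a ?t"
  proof unfold_locales
    show "?t \<otimes>\<^bsub>?D\<^esub> ?t = \<one>\<^bsub>?D\<^esub>"
      unfolding mult one cl_eq by (rule word_cong.relator) simp
    show "?a \<otimes>\<^bsub>?D\<^esub> ?t = ?t \<otimes>\<^bsub>?D\<^esub> inv\<^bsub>?D\<^esub> ?a"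
      unfolding inv mult cl_eq by (rule word_cong.relator) simp
    fix n :: int
    assume n: "?a [^]\<^bsub>?D\<^esub> n = \<one>\<^bsub>?D\<^esub>"
    show "n = 0"
    proof (cases n)
      case (nonneg k)
      then show ?thesis using n nat_inf by (simp add: int_pow_int)
    next
      case (neg k)
      then have "inv\<^bsub>?D\<^esub> (?a [^]\<^bsub>?D\<^esub> (Suc k)) = \<one>\<^bsub>?D\<^esub>"
        using n carr by (metis D.int_pow_neg int_pow_int)
      then have "?a [^]\<^bsub>?D\<^esub> (Suc k) = \<one>\<^bsub>?D\<^esub>" using carr by (metis D.inv_eq_1_iff D.nat_pow_closed)
      then show ?thesis using nat_inf by blast
    qed
  qed (use carr in auto)
  then show ?thesis by blast
qed

text \<open>The relations pass through any homomorphism; infinite order passes through by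
  injectivity.\<close>

lemma infinite_dihedral_iso:
  assumes "infinite_dihedral H a t" "group G" "H \<cong> G"
  shows "\<exists>a t. infinite_dihedral G a t"
proof -
  interpret H: infinite_dihedral H a t by fact
  interpret G: group G by fact
  obtain h where h: "h \<in> iso H G" using assms(3) by (auto simp: is_iso_def)
  then interpret h: group_hom H G h by unfold_locales (simp add: iso_def)
  have inj: "inj_on h (carrier H)" using h by (simp add: iso_def bij_betw_def)
  have "infinite_dihedral G (h a) (h t)"
  proof unfold_locales
    show "h t \<otimes>\<^bsub>G\<^esub> h t = \<one>\<^bsub>G\<^esub>" by (simp flip: h.hom_mult)
    show "h a \<otimes>\<^bsub>G\<^esub> h t = h t \<otimes>\<^bsub>G\<^esub> inv\<^bsub>G\<^esub> h a"
      by (simp add: H.at flip: h.hom_mult h.hom_inv)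
    fix n :: int
    assume "h a [^]\<^bsub>G\<^esub> n = \<one>\<^bsub>G\<^esub>"
    then have "h (a [^]\<^bsub>H\<^esub> n) = h \<one>\<^bsub>H\<^esub>" by (simp add: h.hom_int_pow)
    then have "a [^]\<^bsub>H\<^esub> n = \<one>\<^bsub>H\<^esub>" using inj_onD[OF inj, of "a [^]\<^bsub>H\<^esub> n" "\<one>\<^bsub>H\<^esub>"] by simp
    then show "n = 0" by (rule H.inf)
  qed simp_all
  then show ?thesis by blast
qed

theorem theorem5p2:
  fixes G :: "('a, 'b) monoid_scheme"
  assumes "group G" and "G \<cong> infinite_dihedral_group"
  shows
    "(\<not> seminormal (product_one_monoid G) \<and> \<not> weakly_Krull (product_one_monoid G))
     \<and>
     (length_sets (product_one_monoid G) = {L. L \<subseteq> {2..} \<and> finite L \<and> L \<noteq> {}} \<union> {{0}, {1}} \<and>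
      delta (product_one_monoid G) = {1..} \<and>
      (\<forall>k\<ge>2. unions_of_lengths (product_one_monoid G) k = {2..}))
     \<and>
     (FF_monoid (product_one_monoid G) \<and>
      \<not> locally_tame (product_one_monoid G) \<and>
      catenary_degree (product_one_monoid G) = \<infinity> \<and>
      omega (product_one_monoid G) = \<infinity>)"
proof -
  interpret group G by fact
  have "group infinite_dihedral_group"
    unfolding infinite_dihedral_group_def by (rule presented_group_is_group)
  then have iso: "infinite_dihedral_group \<cong> G" using assms group.iso_sym by blast
  obtain a\<^sub>0 t\<^sub>0 where "infinite_dihedral infinite_dihedral_group a\<^sub>0 t\<^sub>0"
    using infinite_dihedral_group_generators by blast
  from infinite_dihedral_iso[OF this assms(1) iso] obtain a t where "infinite_dihedral G a t"
    by (elim exE)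
  then interpret infinite_dihedral G a t .
  have two: "\<exists>S\<in>carrier B. length_set B S = {2, n}" if "n \<ge> 3" for n
    using ex_length_set_eq[of "{2, n}"] that by simp
  show ?thesis
    using not_seminormal_B not_weakly_Krull_B length_sets_B delta_B unions_of_lengths_B FF_monoid_B
      not_locally_tame_B catenary_degree_B_infinite[OF two] omega_B_infinite[OF two]
    by blast
qed

end
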